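(* For $0\le m\le l$, the reversely weighted averaged normals satisfy $$\|\bar n_{h,*}^m-I_hn_*^m\|_{L^\infty(\hat\Gamma_{h,*}^m)}\lesssim h^2,$$ $$\|\bar n_h^m-I_hn_*^m\|_{L^2(\hat\Gamma_{h,*}^m)}\lesssim h^2+\|\nabla_{\hat\Gamma_{h,*}^m}\hat e_h^m\|_{L^2(\hat\Gamma_{h,*}^m)},$$ $$\|\bar n_{h,*}^m-\hat n_{h,*}^m\|_{L^\infty(\hat\Gamma_{h,*}^m)}\lesssim h .$$
   Context: Exact flow. $\Gamma(t)\subset\mathbb R^2$, $t\in[0,T]$, is a smooth family of closed curves evolving by curve-shortening flow $\partial_tX=-Hn$ with sufficiently smooth flow map and inverse, $n$ a fixed unit normal, $H=\nabla_\Gamma\cdot n$. $\tau$ is the time step, $t_m=m\tau$, $M=\lfloor T/\tau\rfloor$, $\Gamma^m=\Gamma(t_m)$ with unit normal $n^m$; $a^m:U_\delta(\Gamma^m)\to\Gamma^m$ is the closest-point projection from a tubular neighbourhood; $n_*^m=n^m\circ a^m$. $Y^{m+1}:\Gamma^m\to\Gamma^{m+1}$ is the exact local flow map. Finite elements. On a closed polygonal curve $\Sigma$, $S_h(\Sigma)$ is the space of continuous, elementwise affine functions, $I_h$ nodal interpolation, $\nabla_\Sigma$ the elementwise tangential gradient, and $\int_\Sigma^hf=\sum_K\frac{|K|}2\sum_{p\in\mathcal N(K)}f(p)$ is the mass-lumped integral. Finite element functions on polygonal curves with equal connectivity are identified through their nodal vectors (and piecewise constant functions elementwise) and realized on the curve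 indicated. Numerical curves. $\Gamma_h^m$ is the polygonal curve computed by the stabilized Dziuk scheme: given $\Gamma_h^m$, $X_h^{m+1}\in[S_h(\Gamma_h^m)]^2$ satisfies, for all $\phi_h\in[S_h(\Gamma_h^m)]^2$, $\int_{\Gamma_h^m}^h\frac{X_h^{m+1}-{\rm id}}{\tau}\cdot\phi_h+\int_{\Gamma_h^m}\nabla_{\Gamma_h^m}X_h^{m+1}\cdot\nabla_{\Gamma_h^m}\phi_h=\int_{\Gamma_h^m}\nabla_{\Gamma_h^m}{\rm id}\cdot\nabla_{\Gamma_h^m}I_h[\phi_h-(\phi_h\cdot\bar n_h^m)\bar n_h^m]$, and $\Gamma_h^{m+1}=X_h^{m+1}(\Gamma_h^m)$. $X_h^m$ has as nodal values the nodes $x_j^m$ of $\Gamma_h^m$. $\hat X_{h,*}^m$ has nodal values $a^m(x_j^m)$; $\hat\Gamma_{h,*}^m$ is the corresponding polygonal curve with nodes on $\Gamma^m$. $X_{h,*}^{m+1}$ has nodal values $Y^{m+1}(a^m(x_j^m))$. Errors: $\hat e_h^m=X_h^m-\hat X_{h,*}^m$, $e_h^m=X_h^m-X_{h,*}^m$ for $m\ge1$, $e_h^0=\hat e_h^0$. Normals. $\hat n_{h,*}^m$ and $n_h^m$ are the elementwise unit normals of $\hat\Gamma_{h,*}^m$ and $\Gamma_h^m$ (oriented consistently with $n^m$). At a node $p$ between elements of lengths $\ell_-,\ell_+$ of $\hat\Gamma_{h,*}^m$, the finite element function $\bar n_{h,*}^m\in[S_h(\hat\Gamma_{h,*}^m)]^2$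 has nodal value $\bar n_{h,*}^m(p)=\frac{\ell_+\hat n_{h,*}^m(p-)+\ell_-\hat n_{h,*}^m(p+)}{\ell_-+\ell_+}$, where $\pm$ denote the traces from the corresponding elements; $\bar n_h^m$ is defined by the same formula with the lengths and normals of $\Gamma_h^m$. Standing assumptions and constants. The initial mesh is shape regular and quasi-uniform with mesh size $h$ ($c_{\rm q}h\le|K|\le C_{\rm q}h$). With $\Gamma_{h,\rm f}^0=\Gamma_h^0$ the reference polygonal curve, $\kappa_l=\max_{0\le m\le l}\big(\|\hat X_{h,*}^m\|_{W^{1,\infty}(\Gamma_{h,\rm f}^0)}+\|(\hat X_{h,*}^m)^{-1}\|_{W^{1,\infty}(\hat\Gamma_{h,*}^m)}\big)$. Here $l\in\{0,\dots,M-1\}$, and $A\lesssim B$ means $A\le CB$ with $C$ independent of $h,\tau,m$ but possibly depending on $\kappa_l$, $T$, the mesh constants and the smooth exact solution; $h$ is sufficiently small (depending on $\kappa_l$). The induction hypothesis holds for all $0\le m\le l$ (all norms over $\hat\Gamma_{h,*}^m$): $$\|\hat e_h^m\|_{L^2}+\|e_h^m\|_{L^2}+h^{1/2}(\|\hat e_h^m\|_{L^\infty}+\|e_h^m\|_{L^\infty})+h(\|\hat e_h^m\|_{H^1}+\|e_h^m\|_{H^1})+h^{3/2}(\|\hat e_h^m\|_{W^{1,\infty}}+\|e_h^m\|_{W^{1,\infty}})\le h^{7/4}.$$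
   Formalization: The initial polygonal curve is additionally assumed to lie in the tubular neighbourhood and to be mapped homeomorphically onto the initial exact curve by the closest-point projection; without this, folded initial polygons violate the first estimate. *)

theory Defs
  imports "HOL-Analysis.Analysis"
begin

section \<open>The exact flow\<close>

text \<open>
  The curves are parametrised: \<open>\<Gamma>(t) = X t ` {0..<1}\<close> where \<open>X t\<close> is 1-periodic, regular, injective on
  a period, and moves by the flow itself, so that \<open>X t s \<mapsto> X t' s\<close> is the exact flow map.
\<close>

definition curve :: "(real \<Rightarrow> real \<Rightarrow> real^2) \<Rightarrow> real \<Rightarrow> (real^2) set" where
  "curve X t = X t ` {0..<1}"

text \<open>
  Infinitely often differentiable on \<open>[0,T] \<times> \<real>\<close>, with one-sided time derivatives at the end
  points; \<open>D i j\<close> is the derivative of order \<open>i\<close> in time and \<open>j\<close> in the parameter.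
\<close>

definition smooth_family :: "real \<Rightarrow> (real \<Rightarrow> real \<Rightarrow> real^2) \<Rightarrow> bool" where
  "smooth_family T X \<longleftrightarrow>
    (\<exists>D :: nat \<Rightarrow> nat \<Rightarrow> real \<Rightarrow> real \<Rightarrow> real^2.
      (\<forall>t\<in>{0..T}. \<forall>s. D 0 0 t s = X t s) \<and>
      (\<forall>i j. continuous_on ({0..T} \<times> UNIV) (\<lambda>(t, s). D i j t s)) \<and>
      (\<forall>i j. \<forall>t\<in>{0..T}. \<forall>s.
         ((\<lambda>t. D i j t s) has_vector_derivative D (Suc i) j t s) (at t within {0..T}) \<and>
         ((\<lambda>s. D i j t s) has_vector_derivative D i (Suc j) t s) (at s)))"

definition curve_tangent :: "(real \<Rightarrow> real \<Rightarrow> real^2) \<Rightarrow> real \<Rightarrow> real \<Rightarrow> real^2" where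
  "curve_tangent X t s = vector_derivative (X t) (at s)"

text \<open>
  The unit normal to the direction \<open>v\<close>. The sign \<open>\<sigma> \<in> {-1, 1}\<close> selects one of the two continuous
  unit normals of the exact curves; the elements of the polygonal curves, traversed in the direction of
  increasing parameter, receive their normals by the same rule and so are oriented consistently.
\<close>

definition unit_normal :: "real \<Rightarrow> real^2 \<Rightarrow> real^2" where
  "unit_normal \<sigma> v = (\<sigma> / norm v) *\<^sub>R vector [v $ 2, - v $ 1]"

definition curve_normal :: "real \<Rightarrow> (real \<Rightarrow> real \<Rightarrow> real^2) \<Rightarrow> real \<Rightarrow> real \<Rightarrow> real^2" where
  "curve_normal \<sigma> X t s = unit_normal \<sigma> (curve_tangent X t s)"

text \<open>\<open>H = \<nabla>\<^sub>\<Gamma> \<cdot> n\<close>: the tangential divergence is \<open>\<tau> \<cdot> \<partial>\<^sub>\<tau> n\<close> for the unit tangent \<open>\<tau>\<close>.\<close>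

definition curve_curvature :: "real \<Rightarrow> (real \<Rightarrow> real \<Rightarrow> real^2) \<Rightarrow> real \<Rightarrow> real \<Rightarrow> real" where
  "curve_curvature \<sigma> X t s =
    (vector_derivative (curve_normal \<sigma> X t) (at s) \<bullet> curve_tangent X t s)
      / (norm (curve_tangent X t s))\<^sup>2"

definition curve_shortening_flow :: "real \<Rightarrow> real \<Rightarrow> (real \<Rightarrow> real \<Rightarrow> real^2) \<Rightarrow> bool" where
  "curve_shortening_flow T \<sigma> X \<longleftrightarrow>
    0 < T \<and> \<sigma> \<in> {-1, 1} \<and> smooth_family T X \<and>
    (\<forall>t\<in>{0..T}. (\<forall>s. X t (s + 1) = X t s) \<and> inj_on (X t) {0..<1} \<and>
       (\<forall>s. curve_tangent X t s \<noteq> 0)) \<and>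
    (\<forall>t\<in>{0..T}. \<forall>s.
       ((\<lambda>t. X t s) has_vector_derivative
          - curve_curvature \<sigma> X t s *\<^sub>R curve_normal \<sigma> X t s) (at t within {0..T}))"

text \<open>
  \<open>\<delta>\<close> is the radius of a tubular neighbourhood of all \<open>\<Gamma>(t)\<close>. There the closest point is unique and
  \<^const>\<open>closest_point\<close> is the projection.
\<close>

definition tubular_radius :: "real \<Rightarrow> (real \<Rightarrow> real \<Rightarrow> real^2) \<Rightarrow> real \<Rightarrow> bool" where
  "tubular_radius T X \<delta> \<longleftrightarrow>
    0 < \<delta> \<and>
    (\<forall>t\<in>{0..T}. \<forall>p. infdist p (curve X t) < \<delta> \<longrightarrow>
       (\<exists>!q. q \<in> curve X t \<and> dist p q = infdist p (curve X t)))"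

definition proj :: "(real \<Rightarrow> real \<Rightarrow> real^2) \<Rightarrow> real \<Rightarrow> real^2 \<Rightarrow> real^2" where
  "proj X t p = closest_point (curve X t) p"

definition param_of :: "(real \<Rightarrow> real \<Rightarrow> real^2) \<Rightarrow> real \<Rightarrow> real^2 \<Rightarrow> real" where
  "param_of X t p = the_inv_into {0..<1} (X t) p"

definition flow_map :: "(real \<Rightarrow> real \<Rightarrow> real^2) \<Rightarrow> real \<Rightarrow> real \<Rightarrow> real^2 \<Rightarrow> real^2" where
  "flow_map X t t' p = X t' (param_of X t p)"

text \<open>\<open>n\<^sub>* = n \<circ> a\<close>\<close>

definition normal_ext :: "real \<Rightarrow> (real \<Rightarrow> real \<Rightarrow> real^2) \<Rightarrow> real \<Rightarrow> real^2 \<Rightarrow> real^2" where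
  "normal_ext \<sigma> X t p = curve_normal \<sigma> X t (param_of X t (proj X t p))"


section \<open>Finite elements on closed polygonal curves\<close>

text \<open>
  A closed polygonal curve with \<open>J\<close> nodes is its vector of nodes \<open>x j\<close>, \<open>j < J\<close>; element \<open>j\<close> joins
  \<open>x j\<close> to \<open>x (nxt J j)\<close>. A finite element function is its vector of nodal values and may be realised
  on any curve with \<open>J\<close> nodes. A general elementwise function is given by its values \<open>f j \<theta>\<close> at the
  point of element \<open>j\<close> with affine coordinate \<open>\<theta> \<in> [0,1]\<close>.
\<close>

definition nxt :: "nat \<Rightarrow> nat \<Rightarrow> nat" where
  "nxt J j = Suc j mod J"

definition prv :: "nat \<Rightarrow> nat \<Rightarrow> nat" where
  "prv J j = (j + (J - 1)) mod J"

definition edge :: "nat \<Rightarrow> (nat \<Rightarrow> 'a::real_normed_vector) \<Rightarrow> nat \<Rightarrow> 'a" where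
  "edge J v j = v (nxt J j) - v j"

definition elen :: "nat \<Rightarrow> (nat \<Rightarrow> real^2) \<Rightarrow> nat \<Rightarrow> real" where
  "elen J x j = norm (edge J x j)"

definition fe :: "nat \<Rightarrow> (nat \<Rightarrow> 'a::real_normed_vector) \<Rightarrow> nat \<Rightarrow> real \<Rightarrow> 'a" where
  "fe J v j \<theta> = (1 - \<theta>) *\<^sub>R v j + \<theta> *\<^sub>R v (nxt J j)"

definition interp :: "(nat \<Rightarrow> real^2) \<Rightarrow> (real^2 \<Rightarrow> real^2) \<Rightarrow> nat \<Rightarrow> real^2" where
  "interp x f j = f (x j)"

text \<open>
  The (elementwise constant) tangential gradient on the curve \<open>x\<close>. Row \<open>i\<close> is the gradient of
  component \<open>i\<close>: its derivative in arc length times the unit tangent of the element. The inner product of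
  \<open>real^2^2\<close> is the Frobenius product.
\<close>

definition tgrad :: "nat \<Rightarrow> (nat \<Rightarrow> real^2) \<Rightarrow> (nat \<Rightarrow> real^2) \<Rightarrow> nat \<Rightarrow> real^2^2" where
  "tgrad J x v j =
    (\<chi> i. (edge J v j $ i / elen J x j) *\<^sub>R (edge J x j /\<^sub>R elen J x j))"

definition stiffness :: "nat \<Rightarrow> (nat \<Rightarrow> real^2) \<Rightarrow> (nat \<Rightarrow> real^2) \<Rightarrow> (nat \<Rightarrow> real^2) \<Rightarrow> real" where
  "stiffness J x v w = (\<Sum>j<J. elen J x j * (tgrad J x v j \<bullet> tgrad J x w j))"

definition lumped_integral :: "nat \<Rightarrow> (nat \<Rightarrow> real^2) \<Rightarrow> (nat \<Rightarrow> real) \<Rightarrow> real" where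
  "lumped_integral J x f = (\<Sum>j<J. elen J x j / 2 * (f j + f (nxt J j)))"

text \<open>Norms. All functions below are continuous on closed elements, so suprema are essential suprema.\<close>

definition L2norm ::
    "nat \<Rightarrow> (nat \<Rightarrow> real^2) \<Rightarrow> (nat \<Rightarrow> real \<Rightarrow> 'a::real_normed_vector) \<Rightarrow> real" where
  "L2norm J x f = sqrt (\<Sum>j<J. elen J x j * integral {0..1} (\<lambda>\<theta>. (norm (f j \<theta>))\<^sup>2))"

definition Linfnorm :: "nat \<Rightarrow> (nat \<Rightarrow> real \<Rightarrow> 'a::real_normed_vector) \<Rightarrow> real" where
  "Linfnorm J f = (SUP (j, \<theta>)\<in>{..<J} \<times> {0..1}. norm (f j \<theta>))"

definition H1norm :: "nat \<Rightarrow> (nat \<Rightarrow> real^2) \<Rightarrow> (nat \<Rightarrow> real^2) \<Rightarrow> real" where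
  "H1norm J x v = sqrt ((L2norm J x (fe J v))\<^sup>2 + (L2norm J x (\<lambda>j \<theta>. tgrad J x v j))\<^sup>2)"

definition W1infnorm :: "nat \<Rightarrow> (nat \<Rightarrow> real^2) \<Rightarrow> (nat \<Rightarrow> real^2) \<Rightarrow> real" where
  "W1infnorm J x v = max (Linfnorm J (fe J v)) (Linfnorm J (\<lambda>j \<theta>. tgrad J x v j))"

definition elt_normal :: "real \<Rightarrow> nat \<Rightarrow> (nat \<Rightarrow> real^2) \<Rightarrow> nat \<Rightarrow> real^2" where
  "elt_normal \<sigma> J x j = unit_normal \<sigma> (edge J x j)"

text \<open>Reversely weighted averaged normal (nodal values)\<close>

definition avg_normal :: "real \<Rightarrow> nat \<Rightarrow> (nat \<Rightarrow> real^2) \<Rightarrow> nat \<Rightarrow> real^2" where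
  "avg_normal \<sigma> J x j =
    (elen J x j *\<^sub>R elt_normal \<sigma> J x (prv J j) + elen J x (prv J j) *\<^sub>R elt_normal \<sigma> J x j)
      /\<^sub>R (elen J x (prv J j) + elen J x j)"


section \<open>The stabilized Dziuk scheme and its errors\<close>

definition dziuk_step ::
    "real \<Rightarrow> nat \<Rightarrow> real \<Rightarrow> (nat \<Rightarrow> real^2) \<Rightarrow> (nat \<Rightarrow> real^2) \<Rightarrow> bool" where
  "dziuk_step \<sigma> J \<tau> x y \<longleftrightarrow>
    (\<forall>\<phi> :: nat \<Rightarrow> real^2.
       lumped_integral J x (\<lambda>j. ((y j - x j) /\<^sub>R \<tau>) \<bullet> \<phi> j) + stiffness J x y \<phi>
       = stiffness J x x
           (\<lambda>j. \<phi> j - (\<phi> j \<bullet> avg_normal \<sigma> J x j) *\<^sub>R avg_normal \<sigma> J x j))"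

text \<open>
  The initial polygon approximates \<open>\<Gamma>(0)\<close>: it is quasi-uniform (for curves this includes
  shape regularity), lies in the tubular neighbourhood, and the closest-point projection maps it
  homeomorphically onto \<open>\<Gamma>(0)\<close>, its nodes being numbered in the direction of increasing parameter.
  The last property is expressed by a lift \<open>S\<close> of the projection to the parameter line.
\<close>

definition initial_polygon ::
    "(real \<Rightarrow> real \<Rightarrow> real^2) \<Rightarrow> real \<Rightarrow> real \<Rightarrow> real \<Rightarrow> real \<Rightarrow> nat \<Rightarrow> (nat \<Rightarrow> real^2) \<Rightarrow> bool" where
  "initial_polygon X \<delta> c\<^sub>q C\<^sub>q h J x \<longleftrightarrow>
    3 \<le> J \<and>
    (\<forall>j<J. c\<^sub>q * h \<le> elen J x j \<and> elen J x j \<le> C\<^sub>q * h) \<and>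
    (\<exists>S. continuous_on {0..real J} S \<and> strict_mono_on {0..real J} S \<and> S (real J) = S 0 + 1 \<and>
      (\<forall>j<J. \<forall>\<theta>\<in>{0..1}. infdist (fe J x j \<theta>) (curve X 0) < \<delta> \<and>
         proj X 0 (fe J x j \<theta>) = X 0 (S (real j + \<theta>))))"

text \<open>
  Below \<open>x m j\<close> is the \<open>j\<close>-th node of the numerical curve at time \<open>m \<tau>\<close>. \<open>Xhat\<close> collects the projected
  nodes; \<open>Xstar \<dots> m\<close> (meaningful for \<open>m \<ge> 1\<close>) the images under the exact flow of the projected
  nodes of the preceding time level.
\<close>

definition Xhat ::
    "(real \<Rightarrow> real \<Rightarrow> real^2) \<Rightarrow> real \<Rightarrow> (nat \<Rightarrow> nat \<Rightarrow> real^2) \<Rightarrow> nat \<Rightarrow> nat \<Rightarrow> real^2" where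
  "Xhat X \<tau> x m j = proj X (real m * \<tau>) (x m j)"

definition Xstar ::
    "(real \<Rightarrow> real \<Rightarrow> real^2) \<Rightarrow> real \<Rightarrow> (nat \<Rightarrow> nat \<Rightarrow> real^2) \<Rightarrow> nat \<Rightarrow> nat \<Rightarrow> real^2" where
  "Xstar X \<tau> x m j = flow_map X (real (m - 1) * \<tau>) (real m * \<tau>) (Xhat X \<tau> x (m - 1) j)"

definition ehat ::
    "(real \<Rightarrow> real \<Rightarrow> real^2) \<Rightarrow> real \<Rightarrow> (nat \<Rightarrow> nat \<Rightarrow> real^2) \<Rightarrow> nat \<Rightarrow> nat \<Rightarrow> real^2" where
  "ehat X \<tau> x m j = x m j - Xhat X \<tau> x m j"

definition err ::
    "(real \<Rightarrow> real \<Rightarrow> real^2) \<Rightarrow> real \<Rightarrow> (nat \<Rightarrow> nat \<Rightarrow> real^2) \<Rightarrow> nat \<Rightarrow> nat \<Rightarrow> real^2" where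
  "err X \<tau> x m j = (if m = 0 then ehat X \<tau> x 0 j else x m j - Xstar X \<tau> x m j)"

text \<open>
  Nodal identification makes \<open>x 0\<close>, realised on the curve \<open>Xhat m\<close>, the inverse of \<open>Xhat m\<close>, realised
  on the curve \<open>x 0\<close>. The inverse exists only if no element of \<open>Xhat m\<close> is degenerate; since division
  by zero is zero, this must be required separately.
\<close>

definition kappa ::
    "(real \<Rightarrow> real \<Rightarrow> real^2) \<Rightarrow> real \<Rightarrow> nat \<Rightarrow> (nat \<Rightarrow> nat \<Rightarrow> real^2) \<Rightarrow> nat \<Rightarrow> real" where
  "kappa X \<tau> J x l =
    (MAX m\<in>{..l}. W1infnorm J (x 0) (Xhat X \<tau> x m) + W1infnorm J (Xhat X \<tau> x m) (x 0))"

definition nondegenerate :: "nat \<Rightarrow> (nat \<Rightarrow> real^2) \<Rightarrow> bool" where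
  "nondegenerate J x \<longleftrightarrow> (\<forall>j<J. x (nxt J j) \<noteq> x j)"

definition induction_hypothesis ::
    "(real \<Rightarrow> real \<Rightarrow> real^2) \<Rightarrow> real \<Rightarrow> nat \<Rightarrow> (nat \<Rightarrow> nat \<Rightarrow> real^2) \<Rightarrow> real \<Rightarrow> nat \<Rightarrow> bool" where
  "induction_hypothesis X \<tau> J x h m \<longleftrightarrow>
    (let G = Xhat X \<tau> x m; eh = ehat X \<tau> x m; e = err X \<tau> x m in
      L2norm J G (fe J eh) + L2norm J G (fe J e)
      + h powr (1/2) * (Linfnorm J (fe J eh) + Linfnorm J (fe J e))
      + h * (H1norm J G eh + H1norm J G e)
      + h powr (3/2) * (W1infnorm J G eh + W1infnorm J G e)
      \<le> h powr (7/4))"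

end

theory Submission
  imports Defs
begin

text \<open>
  The nodes of \<open>Xhat m\<close> lie on the exact curve. If they are ordered along it, the element directions to
  both sides of a node have the expansions \<open>T + a Z + O(h\<^sup>2)\<close> and \<open>T - b Z + O(h\<^sup>2)\<close> with the tangent \<open>T\<close>
  and parameter increments \<open>a, b\<close>; the reversed weights \<open>b : a\<close> cancel the terms of first order. The average
  depends Lipschitz continuously on the edges relative to their lengths, so the numerical curve adds the
  gradient of the error.

  The ordering is proved by induction on the time level. Initially it holds because the projected
  elements stay near their nodes. The exact flow preserves it, and by the \<open>W\<^sup>1\<^sup>,\<^sup>\<infinity>\<close> part of the
  induction hypothesis the edges of \<open>Xhat (m + 1)\<close> differ from those of \<open>Xstar (m + 1)\<close> by a small fraction of
  their length, hence point in the same direction along the curve. This is only a sign condition, so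
  nothing accumulates over the time steps. The total length is bounded by comparison with the initial polygon
  through \<open>kappa\<close>.
\<close>

section \<open>Directions and their reversely weighted average\<close>

text \<open>The change of direction splits into \<open>d\<close> over \<open>norm v\<close> and the
  relative change of length along \<open>sgn (v + d)\<close>; each part is at most
  \<open>norm d / norm v\<close>.\<close>

lemma norm_sgn_add_diff_le:
  fixes v d :: "'a::real_inner"
  assumes "v \<noteq> 0"
  shows "norm (sgn (v + d) - sgn v) \<le> 2 * norm d / norm v"
proof (cases "v + d = 0")
  case True
  then have "norm d = norm v"
    by (metis add.inverse_unique norm_minus_cancel)
  then show ?thesis using True assms by (simp add: norm_sgn)
next
  case False
  have "sgn (v + d) - sgn v = d /\<^sub>R norm v + ((norm v - norm (v + d)) / norm v) *\<^sub>R sgn (v + d)"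
  proof -
    have "((norm v - norm (v + d)) / norm v) *\<^sub>R sgn (v + d)
        = (1 / norm (v + d) - 1 / norm v) *\<^sub>R (v + d)"
      using False assms by (simp add: sgn_div_norm diff_divide_distrib divide_inverse algebra_simps)
    then show ?thesis by (simp only:) (simp add: sgn_div_norm divide_inverse algebra_simps)
  qed
  also have "norm \<dots> \<le> norm d / norm v + \<bar>norm v - norm (v + d)\<bar> / norm v"
    by (rule order_trans[OF norm_triangle_ineq]) (use False in \<open>simp add: norm_sgn abs_divide divide_inverse abs_mult\<close>)
  also have "\<dots> \<le> norm d / norm v + norm d / norm v"
  proof -
    have "\<bar>norm v - norm (v + d)\<bar> \<le> norm d"
      by (metis add_diff_cancel_left' norm_minus_commute norm_triangle_ineq3)
    then show ?thesis by (intro add_left_mono divide_right_mono) auto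
  qed
  finally show ?thesis by simp
qed

text \<open>The derivative of \<open>sgn\<close> at \<open>v\<close> in direction \<open>d\<close>:
  the part of \<open>d\<close> orthogonal to \<open>v\<close>, divided by the length of
  \<open>v\<close>.\<close>

definition dsgn :: "'a::real_inner \<Rightarrow> 'a \<Rightarrow> 'a" where
  "dsgn v d = (d - ((v \<bullet> d) / (norm v)\<^sup>2) *\<^sub>R v) /\<^sub>R norm v"

lemma dsgn_add: "dsgn v (d + e) = dsgn v d + dsgn v e"
  by (simp add: dsgn_def inner_add_right add_divide_distrib algebra_simps)

lemma dsgn_scaleR: "dsgn v (k *\<^sub>R d) = k *\<^sub>R dsgn v d"
  by (simp add: dsgn_def algebra_simps)

lemma norm_dsgn_le:
  assumes "v \<noteq> 0"
  shows "norm (dsgn v d) \<le> 2 * norm d / norm v"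
proof -
  have "norm (d - ((v \<bullet> d) / (norm v)\<^sup>2) *\<^sub>R v) \<le> norm d + \<bar>v \<bullet> d\<bar> / norm v"
    using norm_triangle_ineq4[of d "((v \<bullet> d) / (norm v)\<^sup>2) *\<^sub>R v"] assms
    by (simp add: power2_eq_square)
  also have "\<dots> \<le> norm d + norm d"
    using Cauchy_Schwarz_ineq2[of v d] assms by (simp add: field_simps)
  finally show ?thesis
    using assms by (simp add: dsgn_def divide_right_mono divide_inverse mult.commute)
qed

text \<open>Taylor's formula for \<open>sgn\<close> with an explicit constant, derived
  algebraically: only the expansion of \<open>1 / q\<close> has to be found, and
  \<open>q\<^sup>2\<close> is an exact quadratic polynomial in \<open>d\<close>.\<close>

lemma norm_sgn_second_order:
  fixes v d :: "'a::real_inner"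
  assumes "v \<noteq> 0" and d: "norm d \<le> norm v / 2"
  shows "norm (sgn (v + d) - sgn v - dsgn v d) \<le> 8 * (norm d)\<^sup>2 / (norm v)\<^sup>2"
proof -
  define r q x where "r = norm v" and "q = norm (v + d)" and "x = v \<bullet> d"
  have r: "r > 0" using assms by (simp add: r_def)
  have rq: "\<bar>q - r\<bar> \<le> norm d"
    unfolding q_def r_def by (metis add_diff_cancel_left' norm_triangle_ineq3)
  then have "q \<ge> r / 2" using d unfolding r_def[symmetric] by linarith
  then have q: "q \<ge> r / 2" "q > 0" using r by auto
  have q2: "q\<^sup>2 = r\<^sup>2 + 2 * x + (norm d)\<^sup>2"
    unfolding q_def r_def x_def by (simp add: power2_norm_eq_inner inner_simps inner_commute)
  have x: "\<bar>x\<bar> \<le> r * norm d" unfolding x_def r_def by (rule Cauchy_Schwarz_ineq2)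
  have split: "sgn (v + d) - sgn v - dsgn v d
      = (1 / q - 1 / r) *\<^sub>R d + (1 / q - 1 / r + x / r ^ 3) *\<^sub>R v"
  proof -
    have "inverse r * (x * (inverse r)\<^sup>2) = x / r ^ 3"
      using r by (simp add: divide_inverse power3_eq_cube power2_eq_square mult_ac)
    then have "dsgn v d = (1 / r) *\<^sub>R d - (x / r ^ 3) *\<^sub>R v"
      by (simp add: dsgn_def r_def x_def divide_inverse scaleR_diff_right power_inverse)
    moreover have "sgn (v + d) = (1 / q) *\<^sub>R v + (1 / q) *\<^sub>R d" "sgn v = (1 / r) *\<^sub>R v"
      by (simp_all add: sgn_div_norm q_def r_def divide_inverse scaleR_add_right)
    ultimately show ?thesis by (simp add: scaleR_add_left scaleR_diff_left)
  qed
  have "1 / q - 1 / r = (r - q) / (r * q)"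
    using r q by (simp add: field_simps)
  then have "\<bar>1 / q - 1 / r\<bar> = \<bar>q - r\<bar> / (r * q)"
    using r q by (simp add: abs_mult abs_minus_commute)
  then have t1: "\<bar>1 / q - 1 / r\<bar> * norm d \<le> (norm d)\<^sup>2 / (r * q)"
    using rq r q by (simp add: power2_eq_square divide_right_mono mult_right_mono)
  \<comment> \<open>The identity results from eliminating \<open>(norm d)\<^sup>2\<close> through
    \<open>q2\<close>. Its right side is of second order because \<open>x\<close> and
    \<open>q - r\<close> are both of first order in \<open>d\<close>.\<close>
  have "1 / q - 1 / r + x / r ^ 3
      = x * (q - r) * (q + 2 * r) / (r ^ 3 * q * (r + q)) - (norm d)\<^sup>2 / (r * q * (r + q))"
  proof -
    have n: "(norm d)\<^sup>2 = q\<^sup>2 - r\<^sup>2 - 2 * x" using q2 by simp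
    have "r + q \<noteq> 0" "r \<noteq> 0" "q \<noteq> 0" using r q by auto
    then show ?thesis unfolding n
      by (simp add: divide_simps) (simp add: algebra_simps power2_eq_square power3_eq_cube)
  qed
  also have "\<bar>\<dots>\<bar> \<le> 2 * (norm d)\<^sup>2 / (r\<^sup>2 * q) + (norm d)\<^sup>2 / (r\<^sup>2 * q)"
  proof (rule order_trans[OF abs_triangle_ineq4 add_mono])
    have "\<bar>x\<bar> * \<bar>q - r\<bar> * (q + 2 * r) \<le> (r * norm d) * norm d * (2 * (r + q))"
      using x rq r q by (intro mult_mono) auto
    then show "\<bar>x * (q - r) * (q + 2 * r) / (r ^ 3 * q * (r + q))\<bar> \<le> 2 * (norm d)\<^sup>2 / (r\<^sup>2 * q)"
      using r q by (simp add: abs_mult divide_simps power2_eq_square power3_eq_cube)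
        (simp add: algebra_simps)
    show "\<bar>(norm d)\<^sup>2 / (r * q * (r + q))\<bar> \<le> (norm d)\<^sup>2 / (r\<^sup>2 * q)"
    proof -
      have "r\<^sup>2 * q \<le> r * q * (r + q)" using r q by (simp add: power2_eq_square algebra_simps)
      then show ?thesis using r q by (simp add: frac_le)
    qed
  qed
  finally have t2: "\<bar>1 / q - 1 / r + x / r ^ 3\<bar> * r \<le> 3 * (norm d)\<^sup>2 / (r * q)"
    using r q by (simp add: field_simps power2_eq_square)
  have "norm (sgn (v + d) - sgn v - dsgn v d)
      \<le> \<bar>1 / q - 1 / r\<bar> * norm d + \<bar>1 / q - 1 / r + x / r ^ 3\<bar> * r"
    unfolding split by (rule order_trans[OF norm_triangle_ineq]) (simp add: r_def)
  also have "\<dots> \<le> (norm d)\<^sup>2 / (r * q) + 3 * (norm d)\<^sup>2 / (r * q)"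
    by (rule add_mono[OF t1 t2])
  also have "\<dots> = 4 * (norm d)\<^sup>2 / (r * q)" by (simp flip: add_divide_distrib)
  \<comment> \<open>The bound \<open>q \<ge> r / 2\<close> turns the factor 4 into the 8 of the
    claim.\<close>
  also have "\<dots> \<le> 4 * (norm d)\<^sup>2 / (r * (r / 2))"
    using r q by (intro divide_left_mono mult_left_mono) auto
  finally show ?thesis by (simp add: r_def power2_eq_square)
qed

text \<open>The average behind \<open>avg_normal\<close>, for edge directions instead of normals:
  \<open>d\<close> is the edge arriving at a node, \<open>e\<close> the one leaving it, and each
  direction carries the length of the other edge as weight.\<close>

definition rw_avg :: "'a::real_normed_vector \<Rightarrow> 'a \<Rightarrow> 'a" where
  "rw_avg d e = (norm e *\<^sub>R sgn d + norm d *\<^sub>R sgn e) /\<^sub>R (norm d + norm e)"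

text \<open>The weights sum to 1, so a reference vector \<open>u\<close> can be subtracted inside
  the average.\<close>

lemma rw_avg_diff:
  assumes "d \<noteq> 0" "e \<noteq> 0"
  shows "rw_avg d e - u =
    (norm e / (norm d + norm e)) *\<^sub>R (sgn d - u) + (norm d / (norm d + norm e)) *\<^sub>R (sgn e - u)"
proof -
  have "norm d + norm e > 0" using assms by (simp add: add_pos_pos)
  then have "u = (norm e / (norm d + norm e)) *\<^sub>R u + (norm d / (norm d + norm e)) *\<^sub>R u"
    by (simp add: add.commute flip: scaleR_add_left add_divide_distrib)
  then show ?thesis unfolding rw_avg_def
    by (simp add: algebra_simps divide_inverse)
qed

text \<open>To first order the arriving and leaving directions deviate from \<open>sgn v\<close> by
  \<open>- b\<close> and \<open>a\<close> times \<open>dsgn v w\<close>, while the reversed weights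
  are nearly in the ratio \<open>a\<close> to \<open>b\<close>. The first-order terms therefore
  cancel up to the difference of the two edge lengths per unit parameter, which is itself of first
  order.\<close>

lemma rw_avg_consistency:
  fixes v w :: "'a::real_inner"
  assumes c: "0 < c" "c \<le> norm v" and w: "norm w \<le> B" and B: "c \<le> B"
    and a: "0 < a" "B * a \<le> c / 4" "a \<le> m" and b: "0 < b" "B * b \<le> c / 4" "b \<le> m"
    and p: "norm p \<le> B * a\<^sup>2" and q: "norm q \<le> B * b\<^sup>2"
  shows "norm (rw_avg (b *\<^sub>R (v - b *\<^sub>R w + q)) (a *\<^sub>R (v + a *\<^sub>R w + p)) - sgn v)
    \<le> 42 * (B / c)\<^sup>2 * m\<^sup>2"
proof -
  define P where "P = a *\<^sub>R w + p"
  define Q where "Q = - (b *\<^sub>R w) + q"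
  have vP: "v + P = v + a *\<^sub>R w + p" and vQ: "v + Q = v - b *\<^sub>R w + q"
    by (simp_all add: P_def Q_def)
  have v: "v \<noteq> 0" "norm v > 0" using c by auto
  have B0: "B > 0" using c B by simp
  \<comment> \<open>Stated for signed \<open>k\<close>: \<open>k = a\<close> serves the leaving edge
    and \<open>k = - b\<close> the arriving one. The same holds for \<open>rem\<close>
    below.\<close>
  have small: "norm (k *\<^sub>R w + z) \<le> 2 * B * \<bar>k\<bar>"
      if "\<bar>k\<bar> * B \<le> c / 4" "norm z \<le> B * k\<^sup>2" for k z
  proof -
    have "\<bar>k\<bar> * c \<le> \<bar>k\<bar> * B" using B by (simp add: mult_left_mono)
    then have "\<bar>k\<bar> * c \<le> 1 * c" using that(1) c by linarith
    then have "\<bar>k\<bar> \<le> 1" using c(1) by (rule mult_right_le_imp_le)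
    then have "\<bar>k\<bar> * \<bar>k\<bar> \<le> \<bar>k\<bar> * 1" by (intro mult_left_mono) auto
    then have "B * k\<^sup>2 \<le> B * \<bar>k\<bar>" using B0 by (simp add: power2_eq_square)
    moreover have "norm (k *\<^sub>R w + z) \<le> \<bar>k\<bar> * norm w + norm z"
      by (rule order_trans[OF norm_triangle_ineq]) simp
    moreover have "\<bar>k\<bar> * norm w \<le> \<bar>k\<bar> * B" using w by (simp add: mult_left_mono)
    ultimately show ?thesis using that(2) mult.commute[of B "\<bar>k\<bar>"] by linarith
  qed
  have P: "norm P \<le> 2 * B * a" using small[of a p] a p by (simp add: P_def mult.commute)
  have Q: "norm Q \<le> 2 * B * b" using small[of "-b" q] b q by (simp add: Q_def mult.commute)
  have P2: "norm P \<le> norm v / 2" and Q2: "norm Q \<le> norm v / 2" using P Q a b c by auto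
  have low: "c / 2 \<le> norm (v + z)" if "norm z \<le> norm v / 2" for z
    using that c norm_diff_ineq[of v z] by simp
  have lP: "c / 2 \<le> norm (v + P)" and lQ: "c / 2 \<le> norm (v + Q)" using low P2 Q2 by auto
  have rem: "norm (sgn (v + k *\<^sub>R w + z) - sgn v - k *\<^sub>R dsgn v w) \<le> 34 * (B / c)\<^sup>2 * m\<^sup>2"
    if k: "\<bar>k\<bar> * B \<le> c / 4" and z: "norm z \<le> B * k\<^sup>2" and km: "\<bar>k\<bar> \<le> m" for k z
  proof -
    let ?d = "k *\<^sub>R w + z"
    have d: "norm ?d \<le> 2 * B * \<bar>k\<bar>" by (rule small[OF k z])
    moreover have "2 * B * \<bar>k\<bar> = 2 * (\<bar>k\<bar> * B)" by simp
    ultimately have d2: "norm ?d \<le> norm v / 2" using k c by linarith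
    have "sgn (v + k *\<^sub>R w + z) - sgn v - k *\<^sub>R dsgn v w
        = (sgn (v + ?d) - sgn v - dsgn v ?d) + dsgn v z"
      by (simp add: dsgn_add dsgn_scaleR add.assoc)
    also have "norm \<dots> \<le> 8 * (norm ?d)\<^sup>2 / (norm v)\<^sup>2 + 2 * norm z / norm v"
      using norm_sgn_second_order[OF v(1) d2] norm_dsgn_le[OF v(1), of z]
      by (intro order_trans[OF norm_triangle_ineq] add_mono) auto
    also have "\<dots> \<le> 8 * (2 * B * \<bar>k\<bar>)\<^sup>2 / c\<^sup>2 + 2 * (B * k\<^sup>2) / c"
      using d z c by (intro add_mono frac_le power_mono mult_left_mono) (auto simp: B0 less_imp_le)
    also have "\<dots> = (32 * (B / c)\<^sup>2 + 2 * (B / c)) * k\<^sup>2"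
      by (simp add: power_mult_distrib power_divide algebra_simps)
    \<comment> \<open>Since \<open>1 \<le> B / c\<close>, the term linear in \<open>B / c\<close> is
      absorbed by the quadratic one, and 32 + 2 = 34.\<close>
    also have "\<dots> \<le> (34 * (B / c)\<^sup>2) * m\<^sup>2"
    proof -
      have 1: "1 \<le> B / c" using B c by simp
      then have "B / c \<le> (B / c)\<^sup>2" by (simp add: power2_eq_square mult_left_mono[of 1 "B/c" "B/c", simplified])
      then have "32 * (B / c)\<^sup>2 + 2 * (B / c) \<le> 34 * (B / c)\<^sup>2" by simp
      moreover have "k\<^sup>2 \<le> m\<^sup>2" using km by (metis abs_ge_zero power2_abs power_mono)
      ultimately show ?thesis by (intro mult_mono) auto
    qed
    finally show ?thesis .
  qed
  define E where "E = norm (v + P)"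
  define F where "F = norm (v + Q)"
  define S where "S = b * F + a * E"
  have EF: "E \<ge> c / 2" "F \<ge> c / 2" "E > 0" "F > 0" using lP lQ c by (auto simp: E_def F_def)
  then have "b * (c / 2) \<le> b * F" "a * (c / 2) \<le> a * E" using a b by auto
  moreover have "c / 2 * (a + b) = a * (c / 2) + b * (c / 2)" by (simp add: algebra_simps)
  ultimately have S2: "S \<ge> c / 2 * (a + b)" unfolding S_def by linarith
  have S: "S > 0" using EF a b by (simp add: S_def add_pos_pos)
  define RP where "RP = sgn (v + P) - sgn v - a *\<^sub>R dsgn v w"
  define RQ where "RQ = sgn (v + Q) - sgn v + b *\<^sub>R dsgn v w"
  have RP: "norm RP \<le> 34 * (B / c)\<^sup>2 * m\<^sup>2"
    using rem[of a p] a p by (simp add: RP_def P_def mult.commute add.assoc)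
  have RQ: "norm RQ \<le> 34 * (B / c)\<^sup>2 * m\<^sup>2"
    using rem[of "-b" q] b q unfolding RQ_def vQ by (simp add: mult.commute)
  have "rw_avg (b *\<^sub>R (v - b *\<^sub>R w + q)) (a *\<^sub>R (v + a *\<^sub>R w + p)) - sgn v
      = rw_avg (b *\<^sub>R (v + Q)) (a *\<^sub>R (v + P)) - sgn v"
    by (simp only: vP vQ)
  also have "\<dots> = (a * E / S) *\<^sub>R (sgn (v + Q) - sgn v) + (b * F / S) *\<^sub>R (sgn (v + P) - sgn v)"
    using a b EF by (subst rw_avg_diff) (auto simp: E_def F_def S_def sgn_scaleR)
  \<comment> \<open>What survives of the first-order terms has the factor \<open>F - E\<close>. This
    is at most \<open>2 * B * (a + b)\<close> in size, while \<open>S\<close> is at least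
    \<open>c / 2 * (a + b)\<close>; the sum \<open>a + b\<close> cancels and the product
    \<open>a * b\<close> remains.\<close>
  also have "\<dots> = (a * E / S) *\<^sub>R RQ + (b * F / S) *\<^sub>R RP + (a * b * (F - E) / S) *\<^sub>R dsgn v w"
    by (simp add: RP_def RQ_def algebra_simps diff_divide_distrib)
  also have "norm \<dots> \<le> (a * E / S) * (34 * (B / c)\<^sup>2 * m\<^sup>2) + (b * F / S) * (34 * (B / c)\<^sup>2 * m\<^sup>2)
      + 8 * (B / c)\<^sup>2 * m\<^sup>2"
  proof (intro order_trans[OF norm_triangle_ineq] add_mono)
    show "norm ((a * E / S) *\<^sub>R RQ) \<le> (a * E / S) * (34 * (B / c)\<^sup>2 * m\<^sup>2)"
      using RQ a EF S by (simp add: mult_left_mono del: times_divide_eq_left)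
    show "norm ((b * F / S) *\<^sub>R RP) \<le> (b * F / S) * (34 * (B / c)\<^sup>2 * m\<^sup>2)"
      using RP b EF S by (simp add: mult_left_mono del: times_divide_eq_left)
    have "\<bar>F - E\<bar> \<le> norm (Q - P)"
      unfolding E_def F_def using norm_triangle_ineq3[of "v + Q" "v + P"] by simp
    also have "\<dots> \<le> 2 * B * (a + b)"
      using norm_triangle_ineq4[of Q P] P Q by (simp add: algebra_simps)
    finally have FE: "\<bar>F - E\<bar> \<le> 2 * B * (a + b)" .
    have "norm ((a * b * (F - E) / S) *\<^sub>R dsgn v w) = a * b * \<bar>F - E\<bar> / S * norm (dsgn v w)"
      using a b S by (simp add: abs_mult)
    also have "\<dots> \<le> a * b * (2 * B * (a + b)) / (c / 2 * (a + b)) * (2 * B / c)"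
    proof (intro mult_mono frac_le)
      have "norm (dsgn v w) \<le> 2 * norm w / norm v" by (rule norm_dsgn_le[OF v(1)])
      also have "\<dots> \<le> 2 * B / c" using w c B0 by (intro frac_le) auto
      finally show "norm (dsgn v w) \<le> 2 * B / c" .
    qed (use a b S S2 FE c B0 in auto)
    also have "\<dots> = 8 * (B / c)\<^sup>2 * (a * b)"
    proof -
      have "y * (2 * B * z) / (c / 2 * z) * (2 * B / c) = 8 * (B / c)\<^sup>2 * y" if "z > 0" for y z
        using that c by (simp add: power2_eq_square)
      from this[of "a + b" "a * b"] show ?thesis using a b by (simp only: add_pos_pos)
    qed
    also have "\<dots> \<le> 8 * (B / c)\<^sup>2 * m\<^sup>2"
      using a b by (intro mult_left_mono) (auto simp: power2_eq_square intro: mult_mono)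
    finally show "norm ((a * b * (F - E) / S) *\<^sub>R dsgn v w) \<le> 8 * (B / c)\<^sup>2 * m\<^sup>2" .
  qed
  also have "(a * E / S) * (34 * (B / c)\<^sup>2 * m\<^sup>2) + (b * F / S) * (34 * (B / c)\<^sup>2 * m\<^sup>2)
      = 34 * (B / c)\<^sup>2 * m\<^sup>2"
  proof -
    have "a * E / S + b * F / S = 1" using S by (simp add: S_def add.commute flip: add_divide_distrib)
    then show ?thesis by (metis distrib_right mult_1)
  qed
  finally show ?thesis by (simp add: mult_ac)
qed

text \<open>Directions and weights both depend Lipschitz continuously on the relative perturbations
  \<open>g\<close> and \<open>k\<close> of the edges. The directions contribute \<open>2 * g\<close>
  and \<open>2 * k\<close>, the weights \<open>2 * (g + k)\<close> times a difference of two unit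
  vectors.\<close>

lemma rw_avg_perturb:
  fixes d e :: "'a::real_inner"
  assumes d: "d \<noteq> 0" "norm p \<le> g * norm d" "g \<le> 1/2"
    and e: "e \<noteq> 0" "norm q \<le> k * norm e" "k \<le> 1/2"
  shows "norm (rw_avg (d + p) (e + q) - rw_avg d e) \<le> 6 * (g + k)"
proof -
  \<comment> \<open>A relative perturbation of at most one half keeps at least half of the length,
    so no edge degenerates.\<close>
  have half: "norm (u + z) \<ge> norm u / 2 \<and> u + z \<noteq> 0 \<and> \<bar>norm (u + z) - norm u\<bar> \<le> x * norm u
      \<and> 0 \<le> x \<and> norm (sgn (u + z) - sgn u) \<le> 2 * x"
    if "u \<noteq> 0" "norm z \<le> x * norm u" "x \<le> 1/2" for u z :: 'a and x
  proof (intro conjI)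
    have z: "norm z \<le> norm u / 2"
      using that(2) mult_right_mono[OF that(3) norm_ge_zero, of u] by linarith
    then show *: "norm (u + z) \<ge> norm u / 2" using norm_diff_ineq[of u z] by simp
    then show "u + z \<noteq> 0" using that by auto
    show "\<bar>norm (u + z) - norm u\<bar> \<le> x * norm u"
      using norm_triangle_ineq3[of "u + z" u] that by simp
    show "0 \<le> x" using that by (smt (verit) norm_ge_zero zero_less_norm_iff mult_neg_pos)
    show "norm (sgn (u + z) - sgn u) \<le> 2 * x"
    proof -
      have "norm z / norm u \<le> x" using that by (simp add: pos_divide_le_eq)
      then show ?thesis using norm_sgn_add_diff_le[OF that(1), of z] by simp
    qed
  qed
  note hd = half[OF d] and he = half[OF e]
  define S where "S = norm d + norm e"
  define S' where "S' = norm (d + p) + norm (e + q)"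
  define l where "l = norm e / S"
  define l' where "l' = norm (e + q) / S'"
  have S: "S > 0" "S' \<ge> S / 2" "S' > 0"
    using hd he d e by (auto simp: S_def S'_def add_pos_pos)
  have avg: "rw_avg d e = l *\<^sub>R sgn d + (1 - l) *\<^sub>R sgn e"
    using S rw_avg_diff[of d e 0] d e by (simp add: l_def S_def diff_divide_eq_iff divide_simps)
  have avg': "rw_avg (d + p) (e + q) = l' *\<^sub>R sgn (d + p) + (1 - l') *\<^sub>R sgn (e + q)"
    using S rw_avg_diff[of "d + p" "e + q" 0] hd he
    by (simp add: l'_def S'_def divide_simps)
  have l': "0 \<le> l'" "l' \<le> 1" using S by (auto simp: l'_def S'_def)
  have "l' - l = (norm (e + q) * norm d - norm e * norm (d + p)) / (S * S')"
    using S by (simp add: l_def l'_def divide_simps) (simp add: S_def S'_def algebra_simps)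
  also have "\<dots> = ((norm (e + q) - norm e) * norm d - norm e * (norm (d + p) - norm d)) / (S * S')"
    by (simp add: algebra_simps)
  also have "\<bar>\<dots>\<bar> \<le> ((k * norm e) * norm d + norm e * (g * norm d)) / (S * S')"
  proof -
    have "\<bar>(norm (e + q) - norm e) * norm d - norm e * (norm (d + p) - norm d)\<bar>
        \<le> \<bar>norm (e + q) - norm e\<bar> * norm d + norm e * \<bar>norm (d + p) - norm d\<bar>"
      by (rule order_trans[OF abs_triangle_ineq4]) (simp add: abs_mult)
    also have "\<dots> \<le> (k * norm e) * norm d + norm e * (g * norm d)"
      using hd he by (intro add_mono mult_mono) auto
    finally show ?thesis using S by (simp add: abs_mult divide_right_mono)
  qed
  also have "\<dots> = (g + k) * (norm d * norm e / (S * S'))"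
    by (simp add: field_simps)
  also have "\<dots> \<le> (g + k) * 2"
  proof (intro mult_left_mono)
    have "norm d * norm e \<le> S * S" unfolding S_def by (intro mult_mono) auto
    also have "\<dots> \<le> S * (2 * S')" using S by (intro mult_left_mono) auto
    finally show "norm d * norm e / (S * S') \<le> 2" using S by (simp add: divide_simps mult_ac)
  qed (use hd he in auto)
  finally have ll: "\<bar>l' - l\<bar> \<le> 2 * (g + k)" by simp
  have "rw_avg (d + p) (e + q) - rw_avg d e = l' *\<^sub>R (sgn (d + p) - sgn d)
      + (1 - l') *\<^sub>R (sgn (e + q) - sgn e) + (l' - l) *\<^sub>R (sgn d - sgn e)"
    unfolding avg avg' by (simp add: algebra_simps)
  also have "norm \<dots> \<le> 1 * (2 * g) + 1 * (2 * k) + 2 * (g + k) * 2"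
  proof (intro order_trans[OF norm_triangle_ineq] add_mono)
    show "norm (l' *\<^sub>R (sgn (d + p) - sgn d)) \<le> 1 * (2 * g)"
      unfolding norm_scaleR using l' hd by (intro mult_mono) auto
    show "norm ((1 - l') *\<^sub>R (sgn (e + q) - sgn e)) \<le> 1 * (2 * k)"
      unfolding norm_scaleR using l' he by (intro mult_mono) auto
    show "norm ((l' - l) *\<^sub>R (sgn d - sgn e)) \<le> 2 * (g + k) * 2"
      unfolding norm_scaleR using ll hd he norm_triangle_ineq4[of "sgn d" "sgn e"]
      by (intro mult_mono) (auto simp: norm_sgn split: if_splits)
  qed
  finally show ?thesis by simp
qed

section \<open>Closed regular curves\<close>

lemma periodic_add_int:
  fixes f :: "real \<Rightarrow> 'a"
  assumes "\<And>s. f (s + 1) = f s"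
  shows "f (s + of_int k) = f s"
proof (induction k arbitrary: s rule: int_induct[where k = 0])
  case (step1 i)
  then show ?case using assms[of "s + of_int i"] by (simp add: add.assoc)
next
  case (step2 i)
  then show ?case using assms[of "s + of_int i - 1"] by (simp add: algebra_simps)
qed simp

lemma nxt_less: "j < J \<Longrightarrow> nxt J j < J"
  by (simp add: nxt_def)

lemma prv_less: "j < J \<Longrightarrow> prv J j < J"
  by (simp add: prv_def)

lemma nxt_prv: "j < J \<Longrightarrow> nxt J (prv J j) = j"
  by (simp add: nxt_def prv_def mod_Suc_eq Suc_diff_Suc flip: add_Suc_right)

lemma prv_nxt: "j < J \<Longrightarrow> prv J (nxt J j) = j"
  by (cases "Suc j = J") (auto simp: nxt_def prv_def)

text \<open>
  The orientation of the polygon inscribed at the parameters \<open>s\<close>. It depends only on the parameters and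
  is therefore preserved by the exact flow map.
\<close>

definition ascending :: "real \<Rightarrow> nat \<Rightarrow> (nat \<Rightarrow> real) \<Rightarrow> bool" where
  "ascending r J s \<longleftrightarrow> (\<forall>j<J. \<exists>a (k::int). 0 < a \<and> a \<le> r \<and> s (nxt J j) = s j + a + of_int k)"

text \<open>
  \<open>V\<close> and \<open>W\<close> play the role of \<open>Y'\<close> and \<open>Y''\<close>. The derivatives enter only through quantitative bounds,
  so that the constants can be chosen uniformly in time.
\<close>

locale closed_curve =
  fixes Y V W :: "real \<Rightarrow> 'a::real_inner" and c B r \<eta> :: real
  assumes inj: "inj_on Y {0..<1}"
    and periodic: "Y (s + 1) = Y s"
    and V_periodic: "V (s + 1) = V s"
    and taylor1: "norm (Y (s + a) - Y s - a *\<^sub>R V s) \<le> B * a\<^sup>2"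
    and taylor2: "norm (Y (s + a) - Y s - a *\<^sub>R V s - (a\<^sup>2 / 2) *\<^sub>R W s) \<le> B * \<bar>a\<bar> ^ 3"
    and V_lipschitz: "norm (V (s + a) - V s) \<le> B * \<bar>a\<bar>"
    and V_ge: "c \<le> norm (V s)" and V_le: "norm (V s) \<le> B" and W_le: "norm (W s) \<le> B"
    and c_pos: "0 < c" and r_pos: "0 < r" and r_le: "r \<le> 1 / 4" and Br_le: "B * r \<le> c / 4"
    and eta_pos: "0 < \<eta>"
    and separated: "r \<le> a \<Longrightarrow> a \<le> 1 - r \<Longrightarrow> \<eta> \<le> norm (Y (s + a) - Y s)"
begin

section \<open>Local estimates for chords, parameters and tangents\<close>

lemma c_le_B: "c \<le> B"
  using V_ge[of 0] V_le[of 0] by simp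

lemma B_pos: "0 < B"
  using c_le_B c_pos by simp

lemma periodic_int: "Y (s + of_int k) = Y s"
  by (rule periodic_add_int) (rule periodic)

lemma V_periodic_int: "V (s + of_int k) = V s"
  by (rule periodic_add_int) (rule V_periodic)

lemma Y_frac: "Y (frac s) = Y s"
  using periodic_int[of "frac s" "\<lfloor>s\<rfloor>"] by (simp add: frac_def)

lemma Y_eq_imp:
  assumes "Y s = Y t"
  obtains k :: int where "t = s + of_int k"
proof -
  have "frac s = frac t"
    using inj_onD[OF inj, of "frac s" "frac t"] assms by (simp add: Y_frac frac_lt_1)
  then have "t = s + of_int (\<lfloor>t\<rfloor> - \<lfloor>s\<rfloor>)" by (simp add: frac_def)
  then show ?thesis by (rule that)
qed

text \<open>Fixes the meaning of the scale \<open>r\<close>: up to this parameter distance the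
  Taylor remainder is at most a quarter of the smallest possible linear term, so the curve is nearly
  straight.\<close>

lemma remainder_le:
  assumes "\<bar>a\<bar> \<le> r"
  shows "B * a\<^sup>2 \<le> c / 4 * \<bar>a\<bar>"
proof -
  have "B * a\<^sup>2 = B * \<bar>a\<bar> * \<bar>a\<bar>" by (simp add: power2_eq_square)
  also have "\<dots> \<le> B * r * \<bar>a\<bar>" using assms B_pos by (intro mult_right_mono mult_left_mono) auto
  also have "\<dots> \<le> c / 4 * \<bar>a\<bar>" using Br_le by (rule mult_right_mono) simp
  finally show ?thesis .
qed

lemma chord_ge:
  assumes "\<bar>a\<bar> \<le> r"
  shows "c * \<bar>a\<bar> \<le> 2 * norm (Y (s + a) - Y s)"
proof -
  have "\<bar>a\<bar> * c \<le> \<bar>a\<bar> * norm (V s)" using V_ge by (simp add: mult_left_mono)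
  moreover have "norm (a *\<^sub>R V s) \<le> norm (Y (s + a) - Y s) + norm (Y (s + a) - Y s - a *\<^sub>R V s)"
    using norm_triangle_ineq4[of "Y (s + a) - Y s" "Y (s + a) - Y s - a *\<^sub>R V s"] by simp
  moreover have "0 \<le> c * \<bar>a\<bar>" using c_pos by simp
  moreover have "norm (a *\<^sub>R V s) = \<bar>a\<bar> * norm (V s)" "\<bar>a\<bar> * c = c * \<bar>a\<bar>"
    "c / 4 * \<bar>a\<bar> = c * \<bar>a\<bar> / 4" by simp_all
  ultimately show ?thesis
    using taylor1[of s a] remainder_le[OF assms] by linarith
qed

lemma chord_le:
  assumes "\<bar>a\<bar> \<le> r"
  shows "norm (Y (s + a) - Y s) \<le> 2 * B * \<bar>a\<bar>"
proof -
  have "norm (Y (s + a) - Y s) \<le> norm (a *\<^sub>R V s) + norm (Y (s + a) - Y s - a *\<^sub>R V s)"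
    using norm_triangle_ineq[of "a *\<^sub>R V s" "Y (s + a) - Y s - a *\<^sub>R V s"] by simp
  also have "\<dots> \<le> \<bar>a\<bar> * B + c / 4 * \<bar>a\<bar>"
    using taylor1[of s a] remainder_le[OF assms] V_le by (intro add_mono) (auto intro: mult_left_mono)
  also have "\<dots> \<le> \<bar>a\<bar> * B + B * \<bar>a\<bar>"
    using c_le_B c_pos by (intro add_left_mono mult_right_mono) auto
  finally show ?thesis by (simp add: mult_ac)
qed

text \<open>A quantitative inverse of \<open>Y\<close>: \<open>separated\<close> excludes parameter
  differences far from the integers, and \<open>chord_ge\<close> bounds the remaining small
  difference by the chord.\<close>

lemma nearby_param:
  assumes "norm (Y u - Y s) < \<eta>"
  obtains a and k :: int where "\<bar>a\<bar> < r" "u = s + a + of_int k" "\<bar>a\<bar> \<le> 2 / c * norm (Y u - Y s)"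
proof -
  note result = that
  have aux: thesis if a: "\<bar>a\<bar> < r" and u: "u = s + a + of_int k" for a and k :: int
  proof -
    have "c * \<bar>a\<bar> \<le> 2 * norm (Y u - Y s)"
      using chord_ge[of a s] a periodic_int[of "s + a" k] by (simp add: u)
    then have "\<bar>a\<bar> \<le> 2 / c * norm (Y u - Y s)" using c_pos by (simp add: field_simps)
    then show ?thesis by (rule result[OF a u])
  qed
  define d where "d = frac (u - s)"
  have u: "u = s + d + of_int \<lfloor>u - s\<rfloor>" by (simp add: d_def frac_def)
  have d: "0 \<le> d" "d < 1" by (auto simp: d_def frac_lt_1)
  have "Y (s + d) = Y u" using periodic_int[of "s + d" "\<lfloor>u - s\<rfloor>"] u by simp
  then have "\<not> (r \<le> d \<and> d \<le> 1 - r)" using separated[of d s] assms by auto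
  then consider "d < r" | "1 - r < d" by linarith
  then show ?thesis
  proof cases
    case 1
    then show ?thesis using aux[of d] u d by auto
  next
    case 2
    \<comment> \<open>Just below a full turn the difference counts as the small negative
      \<open>d - 1\<close>, with one more turn in \<open>k\<close>.\<close>
    then show ?thesis using aux[of "d - 1" "\<lfloor>u - s\<rfloor> + 1"] u d by auto
  qed
qed

text \<open>A remainder of a quarter gives inner product at least \<open>3 / 4\<close> and chord
  length at most \<open>5 / 4\<close> of their linear values; the quotient is
  \<open>3 / 5\<close>.\<close>

lemma inner_chord_ge:
  assumes "0 < a" "a \<le> r"
  shows "3 / 5 * norm (Y (s + a) - Y s) * norm (V s) \<le> (Y (s + a) - Y s) \<bullet> V s"
proof -
  define v where "v = norm (V s)"
  define R where "R = Y (s + a) - Y s - a *\<^sub>R V s"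
  have E: "Y (s + a) - Y s = a *\<^sub>R V s + R" by (simp add: R_def)
  have v: "0 < v" "c \<le> v" using V_ge[of s] c_pos by (auto simp: v_def)
  have "norm R \<le> c / 4 * a" unfolding R_def
    using taylor1[of s a] remainder_le[of a] assms by simp
  also have "\<dots> \<le> a * v / 4" using v assms by (simp add: mult.commute)
  finally have R: "norm R \<le> a * v / 4" .
  have "norm (Y (s + a) - Y s) \<le> 5 / 4 * (a * v)"
    unfolding E using norm_triangle_ineq[of "a *\<^sub>R V s" R] R assms by (simp add: v_def)
  then have "3 / 5 * norm (Y (s + a) - Y s) * v \<le> 3 / 5 * (5 / 4 * (a * v)) * v"
    using v by (intro mult_left_mono mult_right_mono) auto
  moreover have "\<bar>R \<bullet> V s\<bar> \<le> a * v / 4 * v"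
    using order_trans[OF Cauchy_Schwarz_ineq2[of R "V s"] mult_right_mono[OF R norm_ge_zero]]
    by (simp add: v_def)
  moreover have "(Y (s + a) - Y s) \<bullet> V s = a * v * v + R \<bullet> V s"
    unfolding E by (simp add: inner_add_left v_def mult.assoc flip: power2_eq_square power2_norm_eq_inner)
  ultimately show ?thesis unfolding v_def[symmetric] by (simp add: algebra_simps)
qed

text \<open>For \<open>a \<le> 0\<close> the linear part of the inner product would be nonpositive
  and would dominate the remainder.\<close>

lemma param_increases:
  assumes a: "\<bar>a\<bar> \<le> r" and pos: "0 < (Y (s + a) - Y s) \<bullet> V s"
  shows "0 < a"
proof (rule ccontr)
  assume "\<not> 0 < a"
  then have a0: "a \<le> 0" by simp
  define R where "R = Y (s + a) - Y s - a *\<^sub>R V s"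
  have "norm R \<le> c / 4 * \<bar>a\<bar>" unfolding R_def
    using taylor1[of s a] remainder_le[OF a] by simp
  also have "\<dots> \<le> norm (V s) * \<bar>a\<bar>" using V_ge[of s] c_pos by (intro mult_right_mono) auto
  finally have "\<bar>R \<bullet> V s\<bar> \<le> norm (V s) * \<bar>a\<bar> * norm (V s)"
    using Cauchy_Schwarz_ineq2[of R "V s"] by (meson mult_right_mono norm_ge_zero order_trans)
  moreover have "(Y (s + a) - Y s) \<bullet> V s = a * (norm (V s) * norm (V s)) + R \<bullet> V s"
    by (simp add: R_def inner_diff_left algebra_simps flip: power2_eq_square power2_norm_eq_inner)
  ultimately show False using pos a0 by (simp add: algebra_simps)
qed

text \<open>Carries the order of the parameters \<open>s\<close> and \<open>s + a\<close> over to
  \<open>u\<close> and \<open>u'\<close>. Up to the factor \<open>norm E * norm (V s)\<close>, the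
  product \<open>E \<bullet> V u\<close> is at least \<open>3/5 * 7/8\<close> minus
  \<open>1/8\<close> for the change of the edge minus \<open>1/4\<close> for the change of the
  tangent; this is positive, and \<open>param_increases\<close> applies.\<close>

lemma orientation_transfer:
  assumes a: "0 < a" "a \<le> r" and E: "Y u' \<noteq> Y u" "norm (Y u' - Y u) < \<eta>"
    and near: "norm (Y u - Y s) < \<eta>" "2 * B / c * norm (Y u - Y s) \<le> c / 4"
    and dev: "norm ((Y u' - Y u) - (Y (s + a) - Y s)) \<le> norm (Y u' - Y u) / 8"
  shows "\<exists>b (k::int). 0 < b \<and> b \<le> r \<and> u' = u + b + of_int k"
proof -
  define E where "E = Y u' - Y u"
  define E' where "E' = Y (s + a) - Y s"
  have En: "norm E > 0" using E by (simp add: E_def)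
  obtain x and k :: int where x: "u = s + x + of_int k" "\<bar>x\<bar> \<le> 2 / c * norm (Y u - Y s)"
    using nearby_param[OF near(1)] by metis
  have "norm (V u - V s) \<le> B * \<bar>x\<bar>"
    using V_lipschitz[of s x] V_periodic_int[of "s + x" k] x(1) by simp
  also have "\<dots> \<le> B * (2 / c * norm (Y u - Y s))" using x B_pos by (intro mult_left_mono) auto
  also have "\<dots> \<le> c / 4" using near(2) by (simp add: mult_ac)
  finally have VV: "norm (V u - V s) \<le> c / 4" .
  have dev': "norm (E - E') \<le> norm E / 8" using dev by (simp add: E_def E'_def)
  then have E'n: "7 / 8 * norm E \<le> norm E'" using norm_triangle_ineq2[of E E'] by simp
  have vs: "c \<le> norm (V s)" by (rule V_ge)
  have 1: "3 / 5 * (7 / 8 * norm E) * norm (V s) \<le> E' \<bullet> V s"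
  proof -
    have "3 / 5 * (7 / 8 * norm E) * norm (V s) \<le> 3 / 5 * norm E' * norm (V s)"
      using E'n by (intro mult_right_mono mult_left_mono) auto
    also have "\<dots> \<le> E' \<bullet> V s" unfolding E'_def by (rule inner_chord_ge[OF a])
    finally show ?thesis .
  qed
  have 2: "\<bar>(E - E') \<bullet> V s\<bar> \<le> norm E / 8 * norm (V s)"
    using Cauchy_Schwarz_ineq2[of "E - E'" "V s"] mult_right_mono[OF dev', of "norm (V s)"] by simp
  have 3: "\<bar>E \<bullet> (V u - V s)\<bar> \<le> norm E * (c / 4)"
    using Cauchy_Schwarz_ineq2[of E "V u - V s"] mult_left_mono[OF VV, of "norm E"] by simp
  have 4: "norm E * c \<le> norm E * norm (V s)" "0 < norm E * c" using vs En c_pos by auto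
  have "E \<bullet> V u = E' \<bullet> V s + (E - E') \<bullet> V s + E \<bullet> (V u - V s)"
    by (simp add: inner_diff_left inner_diff_right)
  then have pos: "0 < E \<bullet> V u" using 1 2 3 4 by simp
  obtain b and k' :: int where b: "\<bar>b\<bar> < r" "u' = u + b + of_int k'"
    using nearby_param[OF E(2)] by metis
  have "E = Y (u + b) - Y u" using periodic_int[of "u + b" k'] b by (simp add: E_def)
  then have "0 < b" using param_increases[of b u] pos b by simp
  then show ?thesis using b by auto
qed

text \<open>The third-order remainder is divided by \<open>a\<close>. The sign of \<open>a\<close>
  is left open because the edge arriving at a node needs a negative increment.\<close>

lemma chord_expansion:
  assumes "a \<noteq> 0"
  obtains p where "norm p \<le> B * a\<^sup>2" "Y (s + a) - Y s = a *\<^sub>R (V s + a *\<^sub>R (W s /\<^sub>R 2) + p)"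
proof
  define R where "R = Y (s + a) - Y s - a *\<^sub>R V s - (a\<^sup>2 / 2) *\<^sub>R W s"
  have "norm R \<le> \<bar>a\<bar> * (B * a\<^sup>2)"
    using taylor2[of s a] by (simp add: R_def power3_eq_cube power2_eq_square mult_ac)
  then show "norm (R /\<^sub>R a) \<le> B * a\<^sup>2" using assms by (simp add: field_simps)
  show "Y (s + a) - Y s = a *\<^sub>R (V s + a *\<^sub>R (W s /\<^sub>R 2) + R /\<^sub>R a)"
    using assms by (simp add: R_def scaleR_add_right power2_eq_square)
qed

text \<open>Dividing by the signed \<open>a\<close> makes the first-order part of the quotient equal
  to \<open>V s\<close> on both sides of \<open>s\<close>, so one estimate covers both edges at a
  node.\<close>

lemma sgn_chord:
  assumes "0 < \<bar>a\<bar>"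
  shows "norm (sgn ((Y (s + a) - Y s) /\<^sub>R a) - sgn (V s)) \<le> 2 * (B / c) * \<bar>a\<bar>"
proof -
  define d where "d = (Y (s + a) - Y s - a *\<^sub>R V s) /\<^sub>R a"
  have e: "(Y (s + a) - Y s) /\<^sub>R a = V s + d" using assms by (simp add: d_def scaleR_diff_right)
  have "norm d \<le> B * \<bar>a\<bar>"
    using taylor1[of s a] assms by (simp add: d_def pos_divide_le_eq divide_inverse_commute[symmetric]
        power2_eq_square abs_mult_self_eq flip: abs_mult)
  then have "2 * norm d / norm (V s) \<le> 2 * (B * \<bar>a\<bar>) / c"
    using V_ge[of s] c_pos B_pos by (intro frac_le) auto
  moreover have "V s \<noteq> 0" using V_ge[of s] c_pos by auto
  ultimately show ?thesis unfolding e using norm_sgn_add_diff_le[of "V s" d] by simp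
qed

section \<open>Continuity and compactness of the curve\<close>

lemma continuous_Y: "continuous_on UNIV Y"
proof -
  have "isCont Y s" for s
  proof -
    have "\<forall>\<^sub>F a in at 0. norm (Y (s + a) - Y s) \<le> 2 * B * \<bar>a\<bar>"
      unfolding eventually_at using r_pos chord_le by (intro exI[of _ r]) auto
    moreover have "((\<lambda>a. 2 * B * \<bar>a\<bar>) \<longlongrightarrow> 0) (at 0)"
      by (auto intro!: tendsto_eq_intros)
    ultimately have "((\<lambda>a. Y (s + a) - Y s) \<longlongrightarrow> 0) (at 0)"
      by (rule Lim_null_comparison)
    then show ?thesis by (simp add: isCont_iff LIM_zero_iff)
  qed
  then show ?thesis by (simp add: continuous_at_imp_continuous_on)
qed

lemma range_Y: "range Y = Y ` {0..<1}"
proof -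
  have "Y s \<in> Y ` {0..<1}" for s
    using Y_frac[of s] frac_lt_1[of s] by (intro image_eqI[of _ _ "frac s"]) auto
  then show ?thesis by auto
qed

lemma compact_range_Y: "compact (range Y)"
proof -
  have "range Y = Y ` {0..1}" unfolding range_Y using range_Y by auto
  then show ?thesis
    using compact_continuous_image[of "{0..1}" Y] continuous_on_subset[OF continuous_Y] by simp
qed

lemma Y_the_inv_into: "p \<in> range Y \<Longrightarrow> Y (the_inv_into {0..<1} Y p) = p"
  unfolding range_Y by (rule f_the_inv_into_f[OF inj])

section \<open>Fine polygons inscribed in ascending order\<close>

context
  fixes J :: nat and G :: "nat \<Rightarrow> 'a" and s :: "nat \<Rightarrow> real" and \<delta> :: real
  assumes asc: "ascending r J s" and G: "\<And>j. j < J \<Longrightarrow> G j = Y (s j)"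
    and fine: "\<And>j. j < J \<Longrightarrow> norm (edge J G j) \<le> \<delta>"
begin

text \<open>An edge is needed from both ends: forward from its first node, and backward for the
  average at its second node. Parameters of neighbouring nodes match only up to whole turns, which
  periodicity absorbs.\<close>

lemma edge_param:
  assumes "j < J"
  obtains a where "0 < a" "a \<le> r" "a \<le> 2 / c * \<delta>"
    "edge J G j = Y (s j + a) - Y (s j)" "edge J G j = Y (s (nxt J j)) - Y (s (nxt J j) - a)"
    "V (s (nxt J j)) = V (s j + a)"
proof -
  obtain a and k :: int where a: "0 < a" "a \<le> r" "s (nxt J j) = s j + a + of_int k"
    using asc assms by (auto simp: ascending_def)
  have e: "edge J G j = Y (s j + a) - Y (s j)"
    using G[of j] G[of "nxt J j"] assms nxt_less[OF assms] a(3) periodic_int[of "s j + a" k]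
    by (simp add: edge_def)
  have "c * a \<le> 2 * \<delta>"
    using chord_ge[of a "s j"] a fine[OF assms] by (simp add: e)
  then have "a \<le> 2 / c * \<delta>" using c_pos by (simp add: pos_le_divide_eq mult.commute)
  then show ?thesis
    using that a e periodic_int[of "s j" k] periodic_int[of "s j + a" k] V_periodic_int[of "s j + a" k]
    by (simp add: algebra_simps)
qed

lemma rw_avg_edges:
  assumes j: "j < J"
  shows "norm (rw_avg (edge J G (prv J j)) (edge J G j) - sgn (V (s j)))
    \<le> 42 * (B / c)\<^sup>2 * (2 / c * \<delta>)\<^sup>2"
proof -
  obtain a where a: "0 < a" "a \<le> r" "a \<le> 2 / c * \<delta>" "edge J G j = Y (s j + a) - Y (s j)"
    using edge_param[OF j] by metis
  obtain b where b: "0 < b" "b \<le> r" "b \<le> 2 / c * \<delta>"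
      "edge J G (prv J j) = Y (s j) - Y (s j - b)"
    using edge_param[OF prv_less[OF j]] by (metis nxt_prv[OF j])
  obtain p where p: "norm p \<le> B * a\<^sup>2"
      "edge J G j = a *\<^sub>R (V (s j) + a *\<^sub>R (W (s j) /\<^sub>R 2) + p)"
    using chord_expansion[of a "s j"] a by (metis less_irrefl)
  obtain q where q: "norm q \<le> B * (-b)\<^sup>2"
      "Y (s j + (-b)) - Y (s j) = (-b) *\<^sub>R (V (s j) + (-b) *\<^sub>R (W (s j) /\<^sub>R 2) + q)"
    using chord_expansion[of "-b" "s j"] b by (metis less_irrefl neg_0_less_iff_less neg_equal_0_iff_equal)
  \<comment> \<open>Reversing the chord with increment \<open>- b\<close> gives the arriving edge,
    whose first-order term has the sign opposite to that of the leaving edge.\<close>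
  have "edge J G (prv J j) = - (Y (s j + (-b)) - Y (s j))" using b(4) by simp
  also have "\<dots> = b *\<^sub>R (V (s j) - b *\<^sub>R (W (s j) /\<^sub>R 2) + q)"
    unfolding q(2) by simp
  finally have e: "edge J G (prv J j) = b *\<^sub>R (V (s j) - b *\<^sub>R (W (s j) /\<^sub>R 2) + q)" .
  have Bab: "B * a \<le> c / 4" "B * b \<le> c / 4"
    using a b Br_le B_pos by (meson mult_left_mono less_imp_le order_trans)+
  have "norm (W (s j) /\<^sub>R 2) \<le> B" using W_le[of "s j"] B_pos by simp
  from rw_avg_consistency[OF c_pos V_ge this c_le_B a(1) Bab(1) a(3) b(1) Bab(2) b(3) p(1)] q(1)
  show ?thesis unfolding e p(2) by simp
qed

lemma sgn_edge_left:
  assumes j: "j < J"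
  shows "norm (sgn (edge J G j) - sgn (V (s j))) \<le> 2 * (B / c) * (2 / c * \<delta>)"
proof -
  obtain a where a: "0 < a" "a \<le> r" "a \<le> 2 / c * \<delta>" "edge J G j = Y (s j + a) - Y (s j)"
    using edge_param[OF j] by metis
  have "sgn ((Y (s j + a) - Y (s j)) /\<^sub>R a) = sgn (edge J G j)"
    using a by (simp add: sgn_scaleR)
  then have "norm (sgn (edge J G j) - sgn (V (s j))) \<le> 2 * (B / c) * a"
    using sgn_chord[of a "s j"] a(1) by simp
  also have "\<dots> \<le> 2 * (B / c) * (2 / c * \<delta>)" using a B_pos c_pos by (intro mult_left_mono) auto
  finally show ?thesis .
qed

lemma sgn_edge_right:
  assumes j: "j < J"
  shows "norm (sgn (edge J G j) - sgn (V (s (nxt J j)))) \<le> 2 * (B / c) * (2 / c * \<delta>)"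
proof -
  let ?t = "s (nxt J j)"
  obtain a where a: "0 < a" "a \<le> r" "a \<le> 2 / c * \<delta>" "edge J G j = Y ?t - Y (?t - a)"
    using edge_param[OF j] by metis
  have "(Y (?t + (-a)) - Y ?t) /\<^sub>R (-a) = inverse a *\<^sub>R edge J G j"
    using a by (simp add: a(4) scaleR_diff_right)
  then have "sgn ((Y (?t + (-a)) - Y ?t) /\<^sub>R (-a)) = sgn (edge J G j)"
    using a by (simp add: sgn_scaleR)
  then have "norm (sgn (edge J G j) - sgn (V ?t)) \<le> 2 * (B / c) * a"
    using sgn_chord[of "-a" ?t] a(1) by simp
  also have "\<dots> \<le> 2 * (B / c) * (2 / c * \<delta>)" using a B_pos c_pos by (intro mult_left_mono) auto
  finally show ?thesis .
qed

end

end

section \<open>Constants uniform in time\<close>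

lemma linear_approximation_bound:
  fixes f f' :: "real \<Rightarrow> 'a::real_normed_vector"
  assumes "\<And>x. (f has_vector_derivative f' x) (at x)"
    and "\<And>x. \<bar>x - s\<bar> \<le> \<bar>a\<bar> \<Longrightarrow> norm (f' x - f' s) \<le> M"
  shows "norm (f (s + a) - f s - a *\<^sub>R f' s) \<le> \<bar>a\<bar> * M"
proof -
  have "norm (f (s + a) - f s - (s + a - s) *\<^sub>R f' s) \<le> norm (s + a - s) * M"
  proof (rule vector_differentiable_bound_linearization[where S = "closed_segment s (s + a)"])
    show "norm (f' x - f' s) \<le> M" if "x \<in> closed_segment s (s + a)" for x
      using that assms(2)[of x] by (auto simp: closed_segment_eq_real_ivl split: if_splits)
  qed (auto intro: has_vector_derivative_at_within assms(1))
  then show ?thesis by simp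
qed

lemma has_vector_derivative_periodic:
  fixes f :: "real \<Rightarrow> 'a::real_normed_vector"
  assumes "\<And>s. f (s + 1) = f s" and f: "\<And>s. (f has_vector_derivative f' s) (at s)"
  shows "f' (s + 1) = f' s"
proof -
  have "((\<lambda>s. s + 1) has_vector_derivative 1) (at s)"
    by (auto intro!: derivative_eq_intros)
  from vector_diff_chain_at[OF this f] have "(f has_vector_derivative f' (s + 1)) (at s)"
    by (simp add: o_def assms(1))
  then show ?thesis using f vector_derivative_unique_at by blast
qed

text \<open>The constants come from extrema of jointly continuous functions on compact sets, hence
  hold for all times at once. Periodicity reduces the base parameter to
  \<open>{0..1}\<close>.\<close>

lemma uniform_closed_curves:
  assumes "curve_shortening_flow T \<sigma> X"
  obtains W c B r \<eta> where
    "\<And>t. t \<in> {0..T} \<Longrightarrow> closed_curve (X t) (curve_tangent X t) (W t) c B r \<eta>"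
proof -
  note flow = assms[unfolded curve_shortening_flow_def]
  from flow have T: "0 < T" and "smooth_family T X" by auto
  then obtain D :: "nat \<Rightarrow> nat \<Rightarrow> real \<Rightarrow> real \<Rightarrow> real^2" where
      D: "\<forall>t\<in>{0..T}. \<forall>s. D 0 0 t s = X t s"
      "\<forall>i j. continuous_on ({0..T} \<times> UNIV) (\<lambda>(t, s). D i j t s)"
      "\<forall>i j. \<forall>t\<in>{0..T}. \<forall>s.
         ((\<lambda>t. D i j t s) has_vector_derivative D (Suc i) j t s) (at t within {0..T}) \<and>
         ((\<lambda>s. D i j t s) has_vector_derivative D i (Suc j) t s) (at s)"
    unfolding smooth_family_def by (elim exE conjE)
  have X: "D 0 0 t s = X t s" if "t \<in> {0..T}" for t s using D(1) that by blast
  have cont: "continuous_on ({0..T} \<times> UNIV) (\<lambda>(t, s). D i j t s)" for i j using D(2) by blast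
  have deriv: "(D i j t has_vector_derivative D i (Suc j) t s) (at s)" if "t \<in> {0..T}" for i j t s
    using D(3) that by blast
  from flow have per: "\<And>t s. t \<in> {0..T} \<Longrightarrow> X t (s + 1) = X t s"
    and inj: "\<And>t. t \<in> {0..T} \<Longrightarrow> inj_on (X t) {0..<1}"
    and reg: "\<And>t s. t \<in> {0..T} \<Longrightarrow> curve_tangent X t s \<noteq> 0" by auto
  have D00: "D 0 0 t = X t" if "t \<in> {0..T}" for t using X[OF that] by auto
  have tang: "curve_tangent X t = D 0 1 t" if "t \<in> {0..T}" for t
    using deriv[OF that, of 0 0] vector_derivative_at unfolding curve_tangent_def D00[OF that]
    by fastforce
  have Dper: "D 0 j t (s + 1) = D 0 j t s" if "t \<in> {0..T}" for j t s
  proof (induction j arbitrary: s)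
    case 0
    then show ?case using that by (simp add: X per)
  next
    case (Suc j)
    show ?case by (rule has_vector_derivative_periodic[OF Suc deriv[OF that]])
  qed
  have Dfrac: "D 0 j t (frac s) = D 0 j t s" if "t \<in> {0..T}" for j t s
    using periodic_add_int[of "D 0 j t" "frac s" "\<lfloor>s\<rfloor>"] Dper[OF that] by (simp add: frac_def)
  have frac01: "frac s \<in> {0..1}" for s :: real using frac_lt_1[of s] by simp
  have bounded: "\<exists>b. \<forall>t\<in>{0..T}. \<forall>s. norm (D 0 j t s) \<le> b" for j
  proof -
    have "compact ((\<lambda>(t, s). D 0 j t s) ` ({0..T} \<times> {0..1}))"
      by (intro compact_continuous_image compact_Times continuous_on_subset[OF cont]) auto
    then have "bounded ((\<lambda>(t, s). D 0 j t s) ` ({0..T} \<times> {0..1}))"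
      by (rule compact_imp_bounded)
    then obtain b where b: "\<forall>v\<in>(\<lambda>(t, s). D 0 j t s) ` ({0..T} \<times> {0..1}). norm v \<le> b"
      unfolding bounded_iff by (elim exE)
    have "norm (D 0 j t s) \<le> b" if "t \<in> {0..T}" for t s
    proof -
      have "norm (D 0 j t (frac s)) \<le> b" using b that frac01[of s] by auto
      then show ?thesis by (simp only: Dfrac[OF that])
    qed
    then show ?thesis by blast
  qed
  then obtain b where b: "\<And>j t s. t \<in> {0..T} \<Longrightarrow> norm (D 0 j t s) \<le> b j"
    by metis
  \<comment> \<open>The first and second derivatives are bounded themselves; the bounds of the
    second and third are Lipschitz constants for the first and second.\<close>
  define B where "B = max (b 1) (max (b 2) (b 3))"
  have B: "norm (D 0 j t s) \<le> B" if "t \<in> {0..T}" "j \<in> {1, 2, 3}" for j t s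
    using b[OF that(1), of j s] that(2) unfolding B_def by auto
  have cK: "continuous_on ({0..T} \<times> {0..1}) (\<lambda>p. norm (case p of (t, s) \<Rightarrow> D 0 1 t s))"
    by (rule continuous_on_norm, rule continuous_on_subset[OF cont]) auto
  have K: "compact ({0..T} \<times> {0..1::real})" "{0..T} \<times> {0..1::real} \<noteq> {}"
    using T by (auto intro: compact_Times)
  obtain p where p: "p \<in> {0..T} \<times> {0..1}"
    "\<forall>q\<in>{0..T} \<times> {0..1}. norm (case p of (t, s) \<Rightarrow> D 0 1 t s) \<le> norm (case q of (t, s) \<Rightarrow> D 0 1 t s)"
    using continuous_attains_inf[OF K cK] by (elim bexE)
  define c where "c = norm (D 0 1 (fst p) (snd p))"
  have c: "0 < c" using reg[of "fst p" "snd p"] p tang[of "fst p"] by (auto simp: c_def)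
  have c_le: "c \<le> norm (D 0 1 t s)" if t: "t \<in> {0..T}" for t s
  proof -
    have "c \<le> norm (D 0 1 t (frac s))"
      using p(2) t frac01[of s] by (auto simp: c_def case_prod_beta)
    then show ?thesis by (simp add: Dfrac[OF t])
  qed
  have B0: "0 < B" using B[of 0 1 0] c_le[of 0 0] c T by simp
  define r where "r = min (1/4) (c / (4 * B))"
  have r: "0 < r" "r \<le> 1/4" using c B0 by (auto simp: r_def)
  have Br: "B * r \<le> c / 4"
  proof -
    have "B * r \<le> B * (c / (4 * B))" using B0 by (intro mult_left_mono) (auto simp: r_def)
    then show ?thesis using B0 by simp
  qed
  \<comment> \<open>The chord length over parameter differences in \<open>{r..1 - r}\<close> attains
    its minimum \<open>\<eta>\<close>, which is positive because the curves are injective on a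
    period.\<close>
  define f where "f = (\<lambda>(t, s, a). norm (X t (s + a) - X t s))"
  let ?K = "{0..T} \<times> {0..1::real} \<times> {r..1 - r}"
  have "continuous_on ?K (\<lambda>p. norm ((case (fst p, fst (snd p) + snd (snd p)) of (t, s) \<Rightarrow> D 0 0 t s)
      - (case (fst p, fst (snd p)) of (t, s) \<Rightarrow> D 0 0 t s)))"
    by (intro continuous_on_norm continuous_on_diff continuous_on_compose2[OF cont] continuous_intros)
      auto
  then have cf: "continuous_on ?K f"
    by (rule continuous_on_eq) (auto simp: f_def X)
  have K': "compact ?K" "?K \<noteq> {}" using T r by (auto intro!: compact_Times)
  obtain q where q: "q \<in> ?K" "\<forall>x\<in>?K. f q \<le> f x"
    using continuous_attains_inf[OF K' cf] by (elim bexE)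
  define \<eta> where "\<eta> = f q"
  have per_int: "X t (s + of_int k) = X t s" if "t \<in> {0..T}" for t s k
    by (rule periodic_add_int) (rule per[OF that])
  have X_frac: "X t (frac s) = X t s" if "t \<in> {0..T}" for t s
    using per_int[OF that, of "frac s" "\<lfloor>s\<rfloor>"] by (simp add: frac_def)
  have eta: "0 < \<eta>"
  proof (rule ccontr)
    assume n: "\<not> 0 < \<eta>"
    obtain t s a where e: "q = (t, s, a)" by (cases q)
    have *: "t \<in> {0..T}" "r \<le> a" "a \<le> 1 - r" using q(1) by (auto simp: e)
    have "X t (frac (s + a)) = X t (frac s)"
      using n by (simp add: \<eta>_def e f_def X_frac[OF *(1)])
    then have "frac (s + a) = frac s"
      using inj_onD[OF inj[OF *(1)]] by (simp add: frac_lt_1)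
    \<comment> \<open>The difference \<open>a\<close> would be an integer strictly between 0 and
      1.\<close>
    then have "a = of_int (\<lfloor>s + a\<rfloor> - \<lfloor>s\<rfloor>)" by (simp add: frac_def)
    then have "0 < \<lfloor>s + a\<rfloor> - \<lfloor>s\<rfloor>" "\<lfloor>s + a\<rfloor> - \<lfloor>s\<rfloor> < 1"
      using * r by linarith+
    then show False by linarith
  qed
  have "closed_curve (X t) (curve_tangent X t) (D 0 2 t) c B r \<eta>" if t: "t \<in> {0..T}" for t
  proof
    note d = deriv[OF t, of 0]
    have d0: "(X t has_vector_derivative curve_tangent X t s) (at s)" for s
      using d[of 0 s] by (simp add: D00[OF t] tang[OF t])
    have d1: "(curve_tangent X t has_vector_derivative D 0 2 t s) (at s)" for s
      using d[of 1 s] by (simp add: tang[OF t] numeral_2_eq_2)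
    have d2: "(D 0 2 t has_vector_derivative D 0 3 t s) (at s)" for s
      using d[of 2 s] by (simp add: numeral_3_eq_3 numeral_2_eq_2)
    have lip: "norm (g (s + a) - g s) \<le> B * \<bar>a\<bar>"
      if "\<And>s. (g has_vector_derivative g' s) (at s)" "\<And>s. norm (g' s) \<le> B"
      for g g' :: "real \<Rightarrow> real^2" and s a
    proof -
      have "norm (g (s + a) - g s) \<le> B * norm (s + a - s)"
        using that by (intro differentiable_bound[of UNIV g "\<lambda>s h. h *\<^sub>R g' s"])
          (auto simp: has_vector_derivative_def mult.commute[of B]
            intro!: onorm_le mult_left_mono intro: has_derivative_at_withinI)
      then show ?thesis by simp
    qed
    show lipV: "norm (curve_tangent X t (s + a) - curve_tangent X t s) \<le> B * \<bar>a\<bar>" for s a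
      by (rule lip[OF d1], rule B) (use t in auto)
    have lipW: "norm (D 0 2 t (s + a) - D 0 2 t s) \<le> B * \<bar>a\<bar>" for s a
      by (rule lip[OF d2], rule B) (use t in auto)
    have mono: "B * x \<le> B * y" if "x \<le> y" for x y using that B0 by simp
    have lin: "norm (g (s + a) - g s - a *\<^sub>R g' s) \<le> B * \<bar>a\<bar>\<^sup>2"
      if g: "\<And>s. (g has_vector_derivative g' s) (at s)" "\<And>s a. norm (g' (s + a) - g' s) \<le> B * \<bar>a\<bar>"
      for g g' :: "real \<Rightarrow> real^2" and s a
    proof -
      have "norm (g (s + a) - g s - a *\<^sub>R g' s) \<le> \<bar>a\<bar> * (B * \<bar>a\<bar>)"
      proof (rule linear_approximation_bound[OF g(1)])
        show "norm (g' x - g' s) \<le> B * \<bar>a\<bar>" if "\<bar>x - s\<bar> \<le> \<bar>a\<bar>" for x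
          using g(2)[of s "x - s"] mono[OF that] by simp
      qed
      then show ?thesis by (simp add: power2_eq_square mult_ac)
    qed
    show "norm (X t (s + a) - X t s - a *\<^sub>R curve_tangent X t s) \<le> B * a\<^sup>2" for s a
      using lin[OF d0 lipV, of s a] by simp
    note tV = lin[OF d1 lipW]
    show "norm (X t (s + a) - X t s - a *\<^sub>R curve_tangent X t s - (a\<^sup>2 / 2) *\<^sub>R D 0 2 t s) \<le> B * \<bar>a\<bar> ^ 3" for s a
    proof -
      \<comment> \<open>Subtracting the quadratic term reduces second-order Taylor to the linear
        bound: the derivative \<open>g'\<close> then varies only quadratically near
        \<open>s\<close>.\<close>
      define g where "g = (\<lambda>x. X t x - ((x - s)\<^sup>2 / 2) *\<^sub>R D 0 2 t s)"
      define g' where "g' = (\<lambda>x. curve_tangent X t x - (x - s) *\<^sub>R D 0 2 t s)"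
      have "(g has_vector_derivative g' x) (at x)" for x
        unfolding g_def g'_def
        by (rule derivative_eq_intros d0 refl | simp)+
      moreover have "norm (g' x - g' s) \<le> B * \<bar>a\<bar>\<^sup>2" if "\<bar>x - s\<bar> \<le> \<bar>a\<bar>" for x
      proof -
        have "norm (g' x - g' s) \<le> B * \<bar>x - s\<bar>\<^sup>2" using tV[of s "x - s"] by (simp add: g'_def algebra_simps)
        also have "\<dots> \<le> B * \<bar>a\<bar>\<^sup>2" by (rule mono) (use that in \<open>intro power_mono, auto\<close>)
        finally show ?thesis .
      qed
      ultimately have "norm (g (s + a) - g s - a *\<^sub>R g' s) \<le> \<bar>a\<bar> * (B * \<bar>a\<bar>\<^sup>2)"
        by (rule linear_approximation_bound)
      then show ?thesis by (simp add: g_def g'_def algebra_simps power3_eq_cube power2_eq_square)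
    qed
    show "\<eta> \<le> norm (X t (s + a) - X t s)" if "r \<le> a" "a \<le> 1 - r" for a s
    proof -
      have "\<eta> \<le> norm (X t (frac s + a) - X t (frac s))"
        using q(2)[rule_format, of "(t, frac s, a)"] t that frac01[of s] by (simp add: \<eta>_def f_def)
      also have "X t (frac s + a) = X t (s + a)"
        using per_int[OF t, of "frac s + a" "\<lfloor>s\<rfloor>"] by (simp add: frac_def)
      finally show ?thesis by (simp add: X_frac[OF t])
    qed
  qed (use t inj per Dper tang B c_le c r Br eta in auto)
  then show ?thesis by (rule that)
qed

section \<open>Discrete norms and normals\<close>

text \<open>The clockwise right-angle rotation contained in \<open>unit_normal\<close>. It is linear
  and isometric, so estimates for edge directions become estimates for normals.\<close>

definition quarter_turn :: "real^2 \<Rightarrow> real^2" where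
  "quarter_turn v = vector [v $ 2, - v $ 1]"

lemma linear_quarter_turn: "linear quarter_turn"
  by (rule linearI) (simp_all add: quarter_turn_def vec_eq_iff forall_2)

lemma norm_quarter_turn: "norm (quarter_turn v) = norm v"
  by (simp add: quarter_turn_def norm_eq_sqrt_inner inner_vec_def sum_2 add.commute)

lemma unit_normal_eq: "unit_normal \<sigma> v = \<sigma> *\<^sub>R quarter_turn (sgn v)"
  by (simp add: unit_normal_def quarter_turn_def sgn_div_norm vec_eq_iff forall_2 divide_inverse)

lemma avg_normal_eq:
  "avg_normal \<sigma> J x j = \<sigma> *\<^sub>R quarter_turn (rw_avg (edge J x (prv J j)) (edge J x j))"
  by (simp add: avg_normal_def rw_avg_def elt_normal_def unit_normal_eq elen_def
      linear_add[OF linear_quarter_turn] linear_scale[OF linear_quarter_turn] scaleR_add_right mult_ac)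

lemma norm_quarter_turn_diff:
  assumes "\<bar>\<sigma>\<bar> = 1"
  shows "norm (\<sigma> *\<^sub>R quarter_turn u - \<sigma> *\<^sub>R quarter_turn v) = norm (u - v)"
  using assms norm_quarter_turn[of "u - v"]
  by (simp add: linear_diff[OF linear_quarter_turn] flip: scaleR_diff_right)

text \<open>Every row is a multiple of the same unit tangent, so the Frobenius norm is that of the
  arc length derivative. On a degenerate element both sides are zero by the convention for
  division.\<close>

lemma norm_tgrad: "norm (tgrad J x v j) = norm (edge J v j) / elen J x j"
proof -
  have row: "norm (tgrad J x v j $ i) = \<bar>edge J v j $ i / elen J x j\<bar>" for i
  proof (cases "elen J x j = 0")
    case False
    then show ?thesis by (simp add: tgrad_def abs_mult) (simp add: elen_def abs_mult divide_inverse)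
  qed (simp add: tgrad_def)
  have "norm (tgrad J x v j) = norm (edge J v j /\<^sub>R elen J x j)"
    unfolding norm_vec_def[of "tgrad J x v j"] norm_vec_def[of "edge J v j /\<^sub>R elen J x j"] row
    by (simp add: divide_inverse mult.commute)
  then show ?thesis by (simp add: elen_def divide_inverse mult.commute)
qed

section \<open>Discrete norms in terms of nodal and elementwise values\<close>

lemma norm_fe_le:
  assumes "\<theta> \<in> {0..1}"
  shows "norm (fe J v j \<theta>) \<le> max (norm (v j)) (norm (v (nxt J j)))"
proof -
  have "norm (fe J v j \<theta>) \<le> (1 - \<theta>) * norm (v j) + \<theta> * norm (v (nxt J j))"
    unfolding fe_def using assms by (intro order_trans[OF norm_triangle_ineq]) simp
  also have "\<dots> \<le> (1 - \<theta>) * max (norm (v j)) (norm (v (nxt J j)))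
      + \<theta> * max (norm (v j)) (norm (v (nxt J j)))"
    using assms by (intro add_mono mult_left_mono) auto
  finally show ?thesis by (simp add: algebra_simps)
qed

text \<open>The supremum is meaningful only for a bounded set. Bounds \<open>M j\<close> on each
  element suffice, since the finite sum of their absolute values is a common bound.\<close>

lemma norm_le_Linfnorm:
  assumes "j < J" "\<theta> \<in> {0..1}" and M: "\<And>j \<theta>. j < J \<Longrightarrow> \<theta> \<in> {0..1} \<Longrightarrow> norm (f j \<theta>) \<le> M j"
  shows "norm (f j \<theta>) \<le> Linfnorm J f"
proof -
  have "bdd_above ((\<lambda>(j, \<theta>). norm (f j \<theta>)) ` ({..<J} \<times> {0..1}))"
  proof (rule bdd_aboveI2)
    fix p :: "nat \<times> real" assume p: "p \<in> {..<J} \<times> {0..1}"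
    obtain i \<theta> where e: "p = (i, \<theta>)" by (cases p)
    have "norm (f i \<theta>) \<le> \<bar>M i\<bar>" using M[of i \<theta>] p e by auto
    also have "\<dots> \<le> (\<Sum>i<J. \<bar>M i\<bar>)" using p e by (intro member_le_sum) auto
    finally show "(case p of (j, \<theta>) \<Rightarrow> norm (f j \<theta>)) \<le> (\<Sum>i<J. \<bar>M i\<bar>)" by (simp add: e)
  qed
  from cSUP_upper[OF _ this, of "(j, \<theta>)"] show ?thesis
    unfolding Linfnorm_def using assms(1,2) by simp
qed

lemma Linfnorm_le:
  assumes "0 < J" "\<And>j \<theta>. j < J \<Longrightarrow> \<theta> \<in> {0..1} \<Longrightarrow> norm (f j \<theta>) \<le> M"
  shows "Linfnorm J f \<le> M"
  unfolding Linfnorm_def using assms by (intro cSUP_least) auto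

lemma norm_node_le_Linfnorm:
  assumes "j < J"
  shows "norm (v j) \<le> Linfnorm J (fe J v)"
  using norm_le_Linfnorm[OF assms, of 0 "fe J v", OF _ norm_fe_le] by (simp add: fe_def)

lemma norm_tgrad_le_Linfnorm:
  assumes "j < J"
  shows "norm (tgrad J x v j) \<le> Linfnorm J (\<lambda>j \<theta>. tgrad J x v j)"
  using norm_le_Linfnorm[OF assms, of 0 "\<lambda>j \<theta>. tgrad J x v j" "\<lambda>j. norm (tgrad J x v j)"] by simp

lemma norm_tgrad_le_W1infnorm: "j < J \<Longrightarrow> norm (tgrad J x v j) \<le> W1infnorm J x v"
  using norm_tgrad_le_Linfnorm[of j J x v] by (simp add: W1infnorm_def)

lemma Linfnorm_fe_nonneg: "0 < J \<Longrightarrow> 0 \<le> Linfnorm J (fe J v)"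
  using norm_node_le_Linfnorm[of 0 J v] norm_ge_zero order_trans by blast

lemma W1infnorm_nonneg: "0 < J \<Longrightarrow> 0 \<le> W1infnorm J x v"
  using Linfnorm_fe_nonneg[of J v] by (simp add: W1infnorm_def)

lemma L2norm_nonneg: "0 \<le> L2norm J x f"
  unfolding L2norm_def
proof (intro real_sqrt_ge_zero sum_nonneg mult_nonneg_nonneg)
  \<comment> \<open>If the integrand is not integrable, the integral has the default value
    0.\<close>
  show "0 \<le> integral {0..1} (\<lambda>\<theta>. (norm (f j \<theta>))\<^sup>2)" for j
    by (cases "(\<lambda>\<theta>. (norm (f j \<theta>))\<^sup>2) integrable_on {0..1}")
      (auto intro: integral_nonneg simp: not_integrable_integral)
qed (simp add: elen_def)

lemma H1norm_nonneg: "0 \<le> H1norm J x v"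
  by (simp add: H1norm_def)

lemma L2norm_tgrad:
  "L2norm J x (\<lambda>j \<theta>. tgrad J x v j) = sqrt (\<Sum>j<J. elen J x j * (norm (edge J v j) / elen J x j)\<^sup>2)"
  by (simp add: L2norm_def norm_tgrad)

lemma L2norm_fe_le:
  "L2norm J x (fe J v) \<le> sqrt (\<Sum>j<J. elen J x j * ((norm (v j))\<^sup>2 + (norm (v (nxt J j)))\<^sup>2))"
  unfolding L2norm_def
proof (intro real_sqrt_le_mono sum_mono mult_left_mono)
  fix j
  let ?M = "(norm (v j))\<^sup>2 + (norm (v (nxt J j)))\<^sup>2"
  have "continuous_on {0..1} (\<lambda>\<theta>. (norm (fe J v j \<theta>))\<^sup>2)"
    unfolding fe_def by (intro continuous_intros)
  then have "integral {0..1} (\<lambda>\<theta>. (norm (fe J v j \<theta>))\<^sup>2) \<le> integral {0..1} (\<lambda>\<theta>::real. ?M)"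
  proof (intro integral_le integrable_continuous_real)
    show "(norm (fe J v j \<theta>))\<^sup>2 \<le> ?M" if "\<theta> \<in> {0..1}" for \<theta>
    proof -
      have "(norm (fe J v j \<theta>))\<^sup>2 \<le> (max (norm (v j)) (norm (v (nxt J j))))\<^sup>2"
        by (rule power_mono[OF norm_fe_le[OF that]]) simp
      also have "\<dots> \<le> ?M" by (simp add: max_def)
      finally show ?thesis .
    qed
  qed auto
  then show "integral {0..1} (\<lambda>\<theta>. (norm (fe J v j \<theta>))\<^sup>2) \<le> ?M" by simp
qed (simp add: elen_def)

text \<open>The summands of the hypothesis are nonnegative, so each alone is at most
  \<open>h powr (7/4)\<close>. Dividing by the weights with exponents \<open>1/2\<close> and
  \<open>3/2\<close> leaves \<open>5/4\<close> and \<open>1/4\<close>.\<close>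

lemma induction_hypothesis_bounds:
  assumes ih: "induction_hypothesis X \<tau> J x h m" and h: "0 < h" and j: "j < J"
  shows "norm (ehat X \<tau> x m j) + norm (err X \<tau> x m j) \<le> h powr (5/4)"
    and "norm (tgrad J (Xhat X \<tau> x m) (ehat X \<tau> x m) j)
      + norm (tgrad J (Xhat X \<tau> x m) (err X \<tau> x m) j) \<le> h powr (1/4)"
proof -
  define G e e' where "G = Xhat X \<tau> x m" and "e = ehat X \<tau> x m" and "e' = err X \<tau> x m"
  have J: "0 < J" using j by simp
  note nonneg = L2norm_nonneg Linfnorm_fe_nonneg[OF J] W1infnorm_nonneg[OF J] H1norm_nonneg
  have "L2norm J G (fe J e) + L2norm J G (fe J e')
      + h powr (1/2) * (Linfnorm J (fe J e) + Linfnorm J (fe J e'))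
      + h * (H1norm J G e + H1norm J G e')
      + h powr (3/2) * (W1infnorm J G e + W1infnorm J G e') \<le> h powr (7/4)"
    using ih by (simp add: induction_hypothesis_def Let_def G_def e_def e'_def)
  moreover have "0 \<le> h powr (1/2) * (Linfnorm J (fe J e) + Linfnorm J (fe J e'))"
    "0 \<le> h * (H1norm J G e + H1norm J G e')"
    "0 \<le> h powr (3/2) * (W1infnorm J G e + W1infnorm J G e')"
    by (intro mult_nonneg_nonneg add_nonneg_nonneg nonneg; use h in simp)+
  moreover have "0 \<le> L2norm J G (fe J e)" "0 \<le> L2norm J G (fe J e')" by (rule L2norm_nonneg)+
  ultimately have *: "h powr (1/2) * (Linfnorm J (fe J e) + Linfnorm J (fe J e')) \<le> h powr (7/4)"
    "h powr (3/2) * (W1infnorm J G e + W1infnorm J G e') \<le> h powr (7/4)" by linarith+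
  have pw: "h powr (7/4) = h powr (1/2) * h powr (5/4)" "h powr (7/4) = h powr (3/2) * h powr (1/4)"
    by (simp_all flip: powr_add)
  have "Linfnorm J (fe J e) + Linfnorm J (fe J e') \<le> h powr (5/4)"
    "W1infnorm J G e + W1infnorm J G e' \<le> h powr (1/4)"
    using *(1)[unfolded pw(1)] *(2)[unfolded pw(2)] h by (simp_all add: mult_le_cancel_left)
  then show "norm (ehat X \<tau> x m j) + norm (err X \<tau> x m j) \<le> h powr (5/4)"
    "norm (tgrad J (Xhat X \<tau> x m) (ehat X \<tau> x m) j)
      + norm (tgrad J (Xhat X \<tau> x m) (err X \<tau> x m) j) \<le> h powr (1/4)"
    using norm_node_le_Linfnorm[OF j, of e] norm_node_le_Linfnorm[OF j, of e']
      norm_tgrad_le_W1infnorm[OF j, of G e] norm_tgrad_le_W1infnorm[OF j, of G e']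
    unfolding G_def e_def e'_def by linarith+
qed

text \<open>The gradients of the map from the initial polygon and of its inverse are quotients of
  element lengths, so \<open>kappa\<close> makes the elements comparable in both directions.\<close>

lemma kappa_bounds:
  assumes "kappa X \<tau> J x l \<le> K" "m \<le> l" and j: "j < J"
  shows "norm (edge J (Xhat X \<tau> x m) j) / elen J (x 0) j \<le> K"
    and "norm (edge J (x 0) j) / elen J (Xhat X \<tau> x m) j \<le> K"
proof -
  let ?G = "Xhat X \<tau> x m"
  have J: "0 < J" using j by simp
  have "W1infnorm J (x 0) ?G + W1infnorm J ?G (x 0) \<le> kappa X \<tau> J x l"
    unfolding kappa_def using assms(2) by (intro Max_ge) auto
  then show "norm (edge J ?G j) / elen J (x 0) j \<le> K" "norm (edge J (x 0) j) / elen J ?G j \<le> K"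
    using assms(1) norm_tgrad_le_W1infnorm[OF j, of "x 0" ?G] norm_tgrad_le_W1infnorm[OF j, of ?G "x 0"]
      W1infnorm_nonneg[OF J, of "x 0" ?G] W1infnorm_nonneg[OF J, of ?G "x 0"]
    unfolding norm_tgrad by linarith+
qed

section \<open>Orientation of the projected polygons\<close>

lemma closest_point_on_curve:
  assumes "closed_curve (X t) V W c B r \<eta>"
  shows "proj X t p \<in> range (X t)"
    and "norm (p - proj X t p) \<le> norm (p - X t s)"
    and "X t (param_of X t (proj X t p)) = proj X t p"
    and "proj X t (proj X t p) = proj X t p"
proof -
  interpret closed_curve "X t" V W c B r \<eta> by fact
  have *: "curve X t = range (X t)" by (simp add: curve_def range_Y)
  have cl: "closed (range (X t))" "range (X t) \<noteq> {}"
    using compact_range_Y by (auto simp: compact_imp_closed)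
  show i: "proj X t p \<in> range (X t)"
    unfolding proj_def * by (rule closest_point_in_set[OF cl])
  show "norm (p - proj X t p) \<le> norm (p - X t s)"
    unfolding proj_def * dist_norm[symmetric] by (rule closest_point_le[OF cl(1)]) simp
  show "X t (param_of X t (proj X t p)) = proj X t p"
    unfolding param_of_def by (rule Y_the_inv_into[OF i])
  show "proj X t (proj X t p) = proj X t p"
    using i unfolding proj_def * by (intro closest_point_self) simp
qed

text \<open>
  The projection of an element stays within a distance of order \<open>h\<close> of its first node, which excludes
  that the element winds around the curve.
\<close>

lemma initial_ascending:
  assumes curve: "closed_curve (X 0) V W c B r \<eta>"
    and poly: "initial_polygon X \<delta> c\<^sub>q C\<^sub>q h J x"
    and near: "\<And>j. j < J \<Longrightarrow> norm (x j - proj X 0 (x j)) \<le> \<epsilon>"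
    and small: "2 * (C\<^sub>q * h + \<epsilon>) < \<eta>"
  shows "ascending r J (\<lambda>j. param_of X 0 (proj X 0 (x j)))"
    and "(\<Sum>j<J. elen J (\<lambda>j. proj X 0 (x j)) j) \<le> 2 * B"
proof -
  interpret closed_curve "X 0" V W c B r \<eta> by fact
  note cp = closest_point_on_curve[where X = X and t = 0, OF curve]
  obtain S where S: "continuous_on {0..real J} S" "strict_mono_on {0..real J} S"
      "S (real J) = S 0 + 1"
      "\<forall>j<J. \<forall>\<theta>\<in>{0..1}. infdist (fe J x j \<theta>) (curve X 0) < \<delta> \<and>
         proj X 0 (fe J x j \<theta>) = X 0 (S (real j + \<theta>))"
    and len: "\<And>j. j < J \<Longrightarrow> elen J x j \<le> C\<^sub>q * h"
    using poly unfolding initial_polygon_def by blast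
  have pr: "proj X 0 (fe J x j \<theta>) = X 0 (S (real j + \<theta>))" if "j < J" "\<theta> \<in> {0..1}" for j \<theta>
    using S(4) that by blast
  define d where "d = (\<lambda>j. S (real (Suc j)) - S (real j))"
  have left: "proj X 0 (x j) = X 0 (S (real j))" if "j < J" for j
    using pr[OF that, of 0] by (simp add: fe_def)
  have right: "proj X 0 (x (nxt J j)) = X 0 (S (real j) + d j)" if "j < J" for j
    using pr[OF that, of 1] by (simp add: fe_def d_def add.commute)
  have d: "0 < d j" "d j < r" if j: "j < J" for j
  proof -
    show "0 < d j" unfolding d_def using j strict_mono_onD[OF S(2), of "real j" "real (Suc j)"] by simp
    show "d j < r"
    proof (rule ccontr)
      assume "\<not> d j < r"
      \<comment> \<open>The lift would pass through an advance of exactly \<open>r\<close>, a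
        parameter difference to which \<open>separated\<close> applies.\<close>
      then have "\<exists>u\<ge>real j. u \<le> real (Suc j) \<and> S u = S (real j) + r"
        using r_pos j by (intro IVT' continuous_on_subset[OF S(1)]) (auto simp: d_def)
      then obtain u where u: "real j \<le> u" "u \<le> real (Suc j)" "S u = S (real j) + r" by blast
      define \<theta> where "\<theta> = u - real j"
      have \<theta>: "\<theta> \<in> {0..1}" using u by (simp add: \<theta>_def)
      let ?q = "fe J x j \<theta>" and ?p = "X 0 (S (real j))"
      have q: "proj X 0 ?q = X 0 (S (real j) + r)" using pr[OF j \<theta>] u by (simp add: \<theta>_def)
      have "?q - x j = \<theta> *\<^sub>R edge J x j" by (simp add: fe_def edge_def algebra_simps)
      then have "norm (?q - x j) = \<theta> * elen J x j" using \<theta> by (simp add: elen_def)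
      also have "\<dots> \<le> 1 * (C\<^sub>q * h)"
        using \<theta> len[OF j] by (intro mult_mono) (auto simp: elen_def)
      finally have qp: "norm (?q - ?p) \<le> C\<^sub>q * h + \<epsilon>"
        using near[OF j] norm_triangle_ineq[of "?q - x j" "x j - ?p"] by (simp add: left[OF j])
      have "norm (X 0 (S (real j) + r) - ?p) \<le> norm (?q - ?p) + norm (?q - X 0 (S (real j) + r))"
        using norm_triangle_ineq4[of "?q - ?p" "?q - X 0 (S (real j) + r)"] by simp
      \<comment> \<open>The projection of \<open>?q\<close> is no farther from \<open>?q\<close>
        than the point \<open>?p\<close> of the curve.\<close>
      also have "\<dots> \<le> norm (?q - ?p) + norm (?q - ?p)"
        using cp(2)[of ?q "S (real j)"] by (simp add: q)
      also have "\<dots> \<le> (C\<^sub>q * h + \<epsilon>) + (C\<^sub>q * h + \<epsilon>)" by (rule add_mono[OF qp qp])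
      also have "\<dots> < \<eta>" using small by simp
      finally have "norm (X 0 (S (real j) + r) - ?p) < \<eta>" .
      then show False using separated[of r "S (real j)"] r_le by simp
    qed
  qed
  show "ascending r J (\<lambda>j. param_of X 0 (proj X 0 (x j)))"
    unfolding ascending_def
  proof (intro allI impI)
    fix j assume j: "j < J"
    let ?s = "\<lambda>j. param_of X 0 (proj X 0 (x j))"
    \<comment> \<open>The lift and the parameters given by \<open>param_of\<close> describe the same
      points, hence agree up to integers.\<close>
    have "X 0 (S (real j)) = X 0 (?s j)" "X 0 (S (real j) + d j) = X 0 (?s (nxt J j))"
      using cp(3) left[OF j] right[OF j] by metis+
    then obtain k k' :: int where "?s j = S (real j) + of_int k" "?s (nxt J j) = S (real j) + d j + of_int k'"
      by (metis Y_eq_imp)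
    then have "?s (nxt J j) = ?s j + d j + of_int (k' - k)" by simp
    then show "\<exists>a (k::int). 0 < a \<and> a \<le> r \<and> ?s (nxt J j) = ?s j + a + of_int k"
      using d[OF j] less_imp_le by blast
  qed
  \<comment> \<open>Each edge is at most \<open>2 * B\<close> times its parameter increment, and the
    increments telescope to one full turn.\<close>
  have "(\<Sum>j<J. elen J (\<lambda>j. proj X 0 (x j)) j) \<le> (\<Sum>j<J. 2 * B * d j)"
  proof (rule sum_mono)
    fix j assume "j \<in> {..<J}"
    then have j: "j < J" by simp
    show "elen J (\<lambda>j. proj X 0 (x j)) j \<le> 2 * B * d j"
      using chord_le[of "d j" "S (real j)"] d[OF j] by (simp add: elen_def edge_def left[OF j] right[OF j])
  qed
  also have "\<dots> = 2 * B * (\<Sum>j<J. d j)" by (simp add: sum_distrib_left)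
  also have "(\<Sum>j<J. d j) = 1"
    unfolding d_def using sum_lessThan_telescope[of "\<lambda>j. S (real j)" J] S(3) by simp
  finally show "(\<Sum>j<J. elen J (\<lambda>j. proj X 0 (x j)) j) \<le> 2 * B" by simp
qed

text \<open>\<open>Xstar\<close> at the new level has the parameters of \<open>Xhat\<close> at the
  old one, so it inherits their order. Its edges differ from those of the new \<open>Xhat\<close> by
  at most an eighth of the latter, and \<open>orientation_transfer\<close> applies.\<close>

lemma ascending_step:
  fixes X \<tau> x m
  defines "s \<equiv> \<lambda>m j. param_of X (real m * \<tau>) (Xhat X \<tau> x m j)"
    and "G \<equiv> Xhat X \<tau> x (Suc m)"
  assumes curve: "closed_curve (X (real m * \<tau>)) V W c B r \<eta>"
    and curve': "closed_curve (X (real (Suc m) * \<tau>)) V' W' c B r \<eta>"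
    and asc: "ascending r J (s m)"
    and nondeg: "nondegenerate J G" and fine: "\<And>j. j < J \<Longrightarrow> norm (edge J G j) < \<eta>"
    and near: "\<And>j. j < J \<Longrightarrow> norm (ehat X \<tau> x (Suc m) j) + norm (err X \<tau> x (Suc m) j) \<le> \<epsilon>"
    and \<epsilon>: "\<epsilon> < \<eta>" "2 * B / c * \<epsilon> \<le> c / 4"
    and dev: "\<And>j. j < J \<Longrightarrow>
      norm (tgrad J G (ehat X \<tau> x (Suc m)) j) + norm (tgrad J G (err X \<tau> x (Suc m)) j) \<le> 1 / 8"
  shows "ascending r J (s (Suc m))"
  unfolding ascending_def
proof (intro allI impI)
  fix j assume j: "j < J"
  define Y where "Y = X (real (Suc m) * \<tau>)"
  let ?e = "err X \<tau> x (Suc m)" and ?e' = "ehat X \<tau> x (Suc m)"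
  interpret closed_curve Y V' W' c B r \<eta> unfolding Y_def by (rule curve')
  have G: "Y (s (Suc m) j) = G j" for j
    unfolding Y_def s_def G_def Xhat_def by (rule closest_point_on_curve(3)[where X = X and t = "real (Suc m) * \<tau>", OF curve'])
  have star: "Xstar X \<tau> x (Suc m) j = Y (s m j)" for j
    by (simp add: Xstar_def flow_map_def s_def Y_def)
  \<comment> \<open>The computed node cancels in the difference of the two errors.\<close>
  have diff: "G j - Y (s m j) = ?e j - ?e' j" for j
    by (simp add: err_def ehat_def star G_def)
  obtain a and k :: int where a: "0 < a" "a \<le> r" "s m (nxt J j) = s m j + a + of_int k"
    using asc j by (auto simp: ascending_def)
  have per: "Y (s m (nxt J j)) = Y (s m j + a)" unfolding a(3) by (rule periodic_int)
  have near': "norm (G j - Y (s m j)) \<le> \<epsilon>"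
    using norm_triangle_ineq4[of "?e j" "?e' j"] near[OF j] by (simp add: diff)
  have "Y (s m j) = G j - (?e j - ?e' j)" "Y (s m j + a) = G (nxt J j) - (?e (nxt J j) - ?e' (nxt J j))"
    unfolding diff[symmetric] per[symmetric] by simp_all
  then have "(G (nxt J j) - G j) - (Y (s m j + a) - Y (s m j)) = edge J ?e j - edge J ?e' j"
    by (simp add: edge_def)
  then have "norm ((G (nxt J j) - G j) - (Y (s m j + a) - Y (s m j)))
      \<le> norm (edge J ?e j) + norm (edge J ?e' j)"
    by (metis norm_triangle_ineq4)
  also have "\<dots> \<le> norm (G (nxt J j) - G j) / 8"
  proof -
    have "0 < elen J G j" using nondeg j by (simp add: nondegenerate_def elen_def edge_def)
    then show ?thesis using dev[OF j] unfolding norm_tgrad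
      by (simp add: pos_divide_le_eq elen_def edge_def add.commute flip: add_divide_distrib)
  qed
  finally have dev': "norm ((G (nxt J j) - G j) - (Y (s m j + a) - Y (s m j)))
      \<le> norm (G (nxt J j) - G j) / 8" .
  have "2 * B / c * norm (G j - Y (s m j)) \<le> 2 * B / c * \<epsilon>"
    using near' B_pos c_pos by (intro mult_left_mono) auto
  then show "\<exists>b (k::int). 0 < b \<and> b \<le> r \<and> s (Suc m) (nxt J j) = s (Suc m) j + b + of_int k"
    using orientation_transfer[OF a(1,2), of "s (Suc m) (nxt J j)" "s (Suc m) j" "s m j"]
      near' \<epsilon> dev' nondeg j fine[OF j]
    by (simp add: G nondegenerate_def edge_def)
qed

section \<open>Cyclic sums over the nodes\<close>

lemma reindex_nxt: "(\<Sum>j<J. f (nxt J j)) = (\<Sum>j<J. f j)"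
  by (rule sum.reindex_bij_witness[of _ "prv J" "nxt J"]) (auto simp: nxt_less prv_less nxt_prv prv_nxt)

lemma reindex_prv: "(\<Sum>j<J. f (prv J j)) = (\<Sum>j<J. f j)"
  by (rule sum.reindex_bij_witness[of _ "nxt J" "prv J"]) (auto simp: nxt_less prv_less nxt_prv prv_nxt)

text \<open>Turns nodal bounds involving both adjacent elements into an L2 bound. The
  quasi-uniformity \<open>ratio\<close> exchanges the weight of an element for that of its neighbour
  at the cost of \<open>Q\<close>, after which the cyclic sum is shifted.\<close>

lemma weighted_nodal_sum_le:
  fixes L g F :: "nat \<Rightarrow> real"
  assumes L: "\<And>j. j < J \<Longrightarrow> 0 \<le> L j" and ratio: "\<And>i j. i < J \<Longrightarrow> j < J \<Longrightarrow> L i \<le> Q * L j"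
    and Q: "0 \<le> Q" and F: "\<And>j. j < J \<Longrightarrow> \<bar>F j\<bar> \<le> A + P * (g (prv J j) + g j)"
    and nonneg: "0 \<le> A" "0 \<le> P" "\<And>j. j < J \<Longrightarrow> 0 \<le> g j" and total: "(\<Sum>j<J. L j) \<le> \<Lambda>"
  shows "sqrt (\<Sum>j<J. L j * ((F j)\<^sup>2 + (F (nxt J j))\<^sup>2))
    \<le> sqrt (3 * (1 + Q) * \<Lambda>) * A + 2 * (1 + Q) * P * sqrt (\<Sum>j<J. L j * (g j)\<^sup>2)"
proof -
  define N where "N = (\<Sum>j<J. L j * (g j)\<^sup>2)"
  have N: "0 \<le> N" unfolding N_def using L by (intro sum_nonneg) auto
  have Lam: "0 \<le> \<Lambda>" using total L by (meson lessThan_iff order_trans sum_nonneg)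
  have "(\<Sum>j<J. L j * (g (prv J j))\<^sup>2) \<le> (\<Sum>j<J. Q * (L (prv J j) * (g (prv J j))\<^sup>2))"
    unfolding mult.assoc[symmetric] using ratio prv_less by (intro sum_mono mult_right_mono) auto
  also have "\<dots> = Q * N"
    using reindex_prv[of "\<lambda>j. L j * (g j)\<^sup>2" J] by (simp add: N_def flip: sum_distrib_left)
  finally have prv: "(\<Sum>j<J. L j * (g (prv J j))\<^sup>2) \<le> Q * N" .
  have "(\<Sum>j<J. L j * (F j)\<^sup>2)
      \<le> (\<Sum>j<J. 3 * A\<^sup>2 * L j + 3 * P\<^sup>2 * (L j * (g (prv J j))\<^sup>2 + L j * (g j)\<^sup>2))"
  proof (rule sum_mono)
    fix j assume "j \<in> {..<J}"
    then have j: "j < J" by simp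
    have "(F j)\<^sup>2 \<le> (A + P * (g (prv J j) + g j))\<^sup>2"
      using power_mono[OF F[OF j], of 2] by simp
    \<comment> \<open>The square of a sum of three terms is at most three times the sum of their
      squares; the difference is the sum of the squared pairwise differences.\<close>
    also have "\<dots> \<le> 3 * A\<^sup>2 + 3 * P\<^sup>2 * ((g (prv J j))\<^sup>2 + (g j)\<^sup>2)"
      using sum_squares_ge_zero[of "A - P * g j" "A - P * g (prv J j)"]
        zero_le_power2[of "P * g j - P * g (prv J j)"] zero_le_power2[of "A - P * g j"]
        zero_le_power2[of "A - P * g (prv J j)"]
      by (simp add: power2_eq_square algebra_simps)
    finally have "L j * (F j)\<^sup>2 \<le> L j * (3 * A\<^sup>2 + 3 * P\<^sup>2 * ((g (prv J j))\<^sup>2 + (g j)\<^sup>2))"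
      by (rule mult_left_mono[OF _ L[OF j]])
    then show "L j * (F j)\<^sup>2 \<le> 3 * A\<^sup>2 * L j + 3 * P\<^sup>2 * (L j * (g (prv J j))\<^sup>2 + L j * (g j)\<^sup>2)"
      by (simp add: algebra_simps)
  qed
  also have "\<dots> = 3 * A\<^sup>2 * (\<Sum>j<J. L j) + 3 * P\<^sup>2 * ((\<Sum>j<J. L j * (g (prv J j))\<^sup>2) + N)"
    by (simp add: sum.distrib N_def flip: sum_distrib_left)
  also have "\<dots> \<le> 3 * A\<^sup>2 * \<Lambda> + 3 * P\<^sup>2 * (Q * N + N)"
    using total prv by (intro add_mono mult_left_mono) auto
  finally have FF: "(\<Sum>j<J. L j * (F j)\<^sup>2) \<le> 3 * A\<^sup>2 * \<Lambda> + 3 * P\<^sup>2 * (Q * N + N)" .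
  have "(\<Sum>j<J. L j * (F (nxt J j))\<^sup>2) \<le> (\<Sum>j<J. Q * (L (nxt J j) * (F (nxt J j))\<^sup>2))"
    unfolding mult.assoc[symmetric] using ratio nxt_less by (intro sum_mono mult_right_mono) auto
  also have "\<dots> = Q * (\<Sum>j<J. L j * (F j)\<^sup>2)"
    using reindex_nxt[of "\<lambda>j. L j * (F j)\<^sup>2" J] by (simp flip: sum_distrib_left)
  finally have "(\<Sum>j<J. L j * ((F j)\<^sup>2 + (F (nxt J j))\<^sup>2)) \<le> (1 + Q) * (\<Sum>j<J. L j * (F j)\<^sup>2)"
    by (simp add: sum.distrib distrib_left distrib_right)
  also have "\<dots> \<le> (1 + Q) * (3 * A\<^sup>2 * \<Lambda> + 3 * P\<^sup>2 * (Q * N + N))"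
    using FF Q by (intro mult_left_mono) auto
  also have "\<dots> = 3 * (1 + Q) * \<Lambda> * A\<^sup>2 + 3 * ((1 + Q)\<^sup>2 * P\<^sup>2 * N)"
    by (simp add: algebra_simps power2_eq_square)
  \<comment> \<open>Enlarging 3 to 4 makes the coefficient of \<open>N\<close> a perfect
    square.\<close>
  also have "\<dots> \<le> 3 * (1 + Q) * \<Lambda> * A\<^sup>2 + 4 * ((1 + Q)\<^sup>2 * P\<^sup>2 * N)"
    using N by simp
  also have "\<dots> = 3 * (1 + Q) * \<Lambda> * A\<^sup>2 + (2 * (1 + Q) * P)\<^sup>2 * N"
    by (simp add: power2_eq_square algebra_simps)
  finally have "sqrt (\<Sum>j<J. L j * ((F j)\<^sup>2 + (F (nxt J j))\<^sup>2))
      \<le> sqrt (3 * (1 + Q) * \<Lambda> * A\<^sup>2 + (2 * (1 + Q) * P)\<^sup>2 * N)"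
    by (rule real_sqrt_le_mono)
  also have "\<dots> \<le> sqrt (3 * (1 + Q) * \<Lambda> * A\<^sup>2) + sqrt ((2 * (1 + Q) * P)\<^sup>2 * N)"
    using Q Lam N by (intro sqrt_add_le_add_sqrt) auto
  also have "\<dots> = sqrt (3 * (1 + Q) * \<Lambda>) * A + 2 * (1 + Q) * P * sqrt N"
    using nonneg Q by (simp add: real_sqrt_mult)
  finally show ?thesis by (simp add: N_def)
qed

section \<open>Estimates for the averaged normals\<close>

text \<open>The three estimates at one time level. The inscribed polygon is treated by expansion at
  its nodes; for the numerical polygon the relative perturbation of an edge is exactly the norm of
  the error gradient on that element, which enters through \<open>rw_avg_perturb\<close>.\<close>

lemma averaged_normal_estimates:
  fixes G x nstar :: "nat \<Rightarrow> real^2"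
  assumes curve: "closed_curve Y V W c B r \<eta>" and \<sigma>: "\<bar>\<sigma>\<bar> = 1" and J: "0 < J"
    and asc: "ascending r J s" and G: "\<And>j. j < J \<Longrightarrow> G j = Y (s j)"
    and nstar: "\<And>j. j < J \<Longrightarrow> nstar j = \<sigma> *\<^sub>R quarter_turn (sgn (V (s j)))"
    and h: "0 < h" "h \<le> 1" and fine: "\<And>j. j < J \<Longrightarrow> elen J G j \<le> L * h"
    and pos: "\<And>j. j < J \<Longrightarrow> 0 < elen J G j"
    and ratio: "\<And>i j. i < J \<Longrightarrow> j < J \<Longrightarrow> elen J G i \<le> Q * elen J G j"
    and total: "(\<Sum>j<J. elen J G j) \<le> \<Lambda>"
    and small: "\<And>j. j < J \<Longrightarrow> norm (tgrad J G (\<lambda>j. x j - G j) j) \<le> 1 / 2"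
  defines "A \<equiv> 42 * (B / c)\<^sup>2 * (2 / c * L)\<^sup>2" and "D \<equiv> 2 * (B / c) * (2 / c * L)"
  shows "Linfnorm J (fe J (\<lambda>j. avg_normal \<sigma> J G j - nstar j)) \<le> A * h\<^sup>2"
    and "L2norm J G (fe J (\<lambda>j. avg_normal \<sigma> J x j - nstar j))
      \<le> sqrt (3 * (1 + Q) * \<Lambda>) * A * h\<^sup>2
        + 12 * (1 + Q) * L2norm J G (\<lambda>j \<theta>. tgrad J G (\<lambda>j. x j - G j) j)"
    and "Linfnorm J (\<lambda>j \<theta>. fe J (avg_normal \<sigma> J G) j \<theta> - elt_normal \<sigma> J G j) \<le> (A + D) * h"
proof -
  interpret closed_curve Y V W c B r \<eta> by fact
  have fine': "norm (edge J G j) \<le> L * h" if "j < J" for j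
    using fine[OF that] by (simp add: elen_def)
  have L: "0 \<le> L"
    using fine[OF J] pos[OF J] h by (smt (verit) mult_neg_pos)
  have AD: "0 \<le> A" "0 \<le> D" using B_pos c_pos L by (auto simp: A_def D_def)
  have node: "norm (avg_normal \<sigma> J G j - nstar j) \<le> A * h\<^sup>2" if j: "j < J" for j
    using rw_avg_edges[OF asc G fine' j]
    by (simp add: avg_normal_eq nstar[OF j] norm_quarter_turn_diff[OF \<sigma>] A_def power_mult_distrib power_divide mult_ac)
  have left: "norm (elt_normal \<sigma> J G j - nstar j) \<le> D * h" if j: "j < J" for j
    using sgn_edge_left[OF asc G fine' j]
    by (simp add: elt_normal_def unit_normal_eq nstar[OF j] norm_quarter_turn_diff[OF \<sigma>] D_def mult_ac)
  have right: "norm (elt_normal \<sigma> J G j - nstar (nxt J j)) \<le> D * h" if j: "j < J" for j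
    using sgn_edge_right[OF asc G fine' j]
    by (simp add: elt_normal_def unit_normal_eq nstar[OF nxt_less[OF j]] norm_quarter_turn_diff[OF \<sigma>] D_def mult_ac)
  show "Linfnorm J (fe J (\<lambda>j. avg_normal \<sigma> J G j - nstar j)) \<le> A * h\<^sup>2"
    by (rule Linfnorm_le[OF J], rule order_trans[OF norm_fe_le]) (auto intro: node nxt_less)
  have "h * h \<le> 1 * h" using h by (intro mult_right_mono) auto
  then have "A * h\<^sup>2 \<le> A * h" using AD by (intro mult_left_mono) (auto simp: power2_eq_square)
  then have near: "A * h\<^sup>2 + D * h \<le> (A + D) * h" by (simp add: algebra_simps)
  show "Linfnorm J (\<lambda>j \<theta>. fe J (avg_normal \<sigma> J G) j \<theta> - elt_normal \<sigma> J G j) \<le> (A + D) * h"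
  proof (rule Linfnorm_le[OF J])
    fix j \<theta> assume j: "j < J" and \<theta>: "\<theta> \<in> {0..1::real}"
    let ?n = "elt_normal \<sigma> J G j" and ?a = "avg_normal \<sigma> J G"
    have "norm (?a j - ?n) \<le> (A + D) * h"
      using norm_triangle_ineq4[of "?a j - nstar j" "?n - nstar j"] node[OF j] left[OF j] near by simp
    moreover have "norm (?a (nxt J j) - ?n) \<le> (A + D) * h"
      using norm_triangle_ineq4[of "?a (nxt J j) - nstar (nxt J j)" "?n - nstar (nxt J j)"]
        node[OF nxt_less[OF j]] right[OF j] near by simp
    \<comment> \<open>The element normal is constant, so it may be subtracted from the two nodal
      values before interpolating.\<close>
    moreover have "fe J ?a j \<theta> - ?n = fe J (\<lambda>i. ?a i - ?n) j \<theta>"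
      by (simp add: fe_def algebra_simps)
    ultimately show "norm (fe J ?a j \<theta> - ?n) \<le> (A + D) * h"
      using norm_fe_le[OF \<theta>, of J "\<lambda>i. ?a i - ?n" j] by simp
  qed
  define e where "e = (\<lambda>j. x j - G j)"
  define g where "g = (\<lambda>j. norm (edge J e j) / elen J G j)"
  have g: "0 \<le> g j" for j by (simp add: g_def elen_def)
  have pert: "norm (avg_normal \<sigma> J x j - avg_normal \<sigma> J G j) \<le> 6 * (g (prv J j) + g j)" if j: "j < J" for j
  proof -
    have x: "edge J x i = edge J G i + edge J e i" for i by (simp add: edge_def e_def)
    have *: "edge J G i \<noteq> 0" "norm (edge J e i) \<le> g i * norm (edge J G i)" "g i \<le> 1 / 2" if "i < J" for i
      using pos[OF that] small[OF that] by (auto simp: g_def e_def[symmetric] norm_tgrad elen_def)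
    show ?thesis
      unfolding avg_normal_eq norm_quarter_turn_diff[OF \<sigma>] x
      by (rule rw_avg_perturb[OF *[OF prv_less[OF j]] *[OF j]])
  qed
  have F: "\<bar>norm (avg_normal \<sigma> J x j - nstar j)\<bar> \<le> A * h\<^sup>2 + 6 * (g (prv J j) + g j)" if "j < J" for j
    using node[OF that] pert[OF that]
      norm_triangle_ineq[of "avg_normal \<sigma> J x j - avg_normal \<sigma> J G j" "avg_normal \<sigma> J G j - nstar j"]
    by simp
  have "0 < Q"
  proof (rule ccontr)
    assume "\<not> 0 < Q"
    then have "Q * elen J G 0 \<le> 0" using pos[OF J] by (simp add: mult_nonpos_nonneg)
    then show False using ratio[OF J J] pos[OF J] by linarith
  qed
  then have "L2norm J G (fe J (\<lambda>j. avg_normal \<sigma> J x j - nstar j))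
      \<le> sqrt (3 * (1 + Q) * \<Lambda>) * (A * h\<^sup>2) + 2 * (1 + Q) * 6 * sqrt (\<Sum>j<J. elen J G j * (g j)\<^sup>2)"
    using AD g total ratio pos F
    by (intro order_trans[OF L2norm_fe_le] weighted_nodal_sum_le) (auto intro: less_imp_le)
  then show "L2norm J G (fe J (\<lambda>j. avg_normal \<sigma> J x j - nstar j))
      \<le> sqrt (3 * (1 + Q) * \<Lambda>) * A * h\<^sup>2
        + 12 * (1 + Q) * L2norm J G (\<lambda>j \<theta>. tgrad J G (\<lambda>j. x j - G j) j)"
    unfolding L2norm_tgrad g_def e_def by (simp add: mult.assoc)
qed

section \<open>Choice of the constants and conclusion\<close>

theorem lemma2p3:
  fixes X :: "real \<Rightarrow> real \<Rightarrow> real^2" and T \<sigma> \<delta> c\<^sub>q C\<^sub>q K :: real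
  assumes "curve_shortening_flow T \<sigma> X"
    and "tubular_radius T X \<delta>"
    and "0 < c\<^sub>q" and "0 < C\<^sub>q"
  shows "\<exists>C>0. \<exists>h\<^sub>0>0.
    \<forall>(h::real) (\<tau>::real) (J::nat) (x :: nat \<Rightarrow> nat \<Rightarrow> real^2) (l::nat).
      0 < h \<and> h \<le> h\<^sub>0 \<and> 0 < \<tau> \<and> l < nat \<lfloor>T / \<tau>\<rfloor> \<and>
      initial_polygon X \<delta> c\<^sub>q C\<^sub>q h J (x 0) \<and>
      (\<forall>m<l. dziuk_step \<sigma> J \<tau> (x m) (x (Suc m))) \<and>
      (\<forall>m\<le>l. nondegenerate J (Xhat X \<tau> x m)) \<and>
      kappa X \<tau> J x l \<le> K \<and>
      (\<forall>m\<le>l. induction_hypothesis X \<tau> J x h m)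
      \<longrightarrow>
      (\<forall>m\<le>l.
        let G = Xhat X \<tau> x m;
            nstar = interp G (normal_ext \<sigma> X (real m * \<tau>))
        in
          Linfnorm J (fe J (\<lambda>j. avg_normal \<sigma> J G j - nstar j)) \<le> C * h\<^sup>2 \<and>
          L2norm J G (fe J (\<lambda>j. avg_normal \<sigma> J (x m) j - nstar j))
            \<le> C * (h\<^sup>2 + L2norm J G (\<lambda>j \<theta>. tgrad J G (ehat X \<tau> x m) j)) \<and>
          Linfnorm J (\<lambda>j \<theta>. fe J (avg_normal \<sigma> J G) j \<theta> - elt_normal \<sigma> J G j) \<le> C * h)"
proof -
  obtain W c B r \<eta> where curves:
    "\<And>t. t \<in> {0..T} \<Longrightarrow> closed_curve (X t) (curve_tangent X t) (W t) c B r \<eta>"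
    using uniform_closed_curves[OF assms(1)] by metis
  have T: "0 < T" and \<sigma>: "\<bar>\<sigma>\<bar> = 1"
    using assms(1) by (auto simp: curve_shortening_flow_def)
  interpret closed_curve "X 0" "curve_tangent X 0" "W 0" c B r \<eta> using curves T by simp
  define K' where "K' = max 1 K"
  define L where "L = K' * C\<^sub>q"
  \<comment> \<open>Initial elements lie between \<open>c\<^sub>q * h\<close> and
    \<open>C\<^sub>q * h\<close>; each comparison of later elements with them costs a factor
    \<open>K'\<close>.\<close>
  define Q where "Q = K'\<^sup>2 * C\<^sub>q / c\<^sub>q"
  \<comment> \<open>The projected initial polygon has length at most \<open>2 * B\<close>; level
    \<open>m\<close> is compared with it through \<open>x 0\<close>, which costs \<open>K'\<close>
    twice.\<close>
  define \<Lambda> where "\<Lambda> = K'\<^sup>2 * (2 * B)"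
  define A where "A = 42 * (B / c)\<^sup>2 * (2 / c * L)\<^sup>2"
  define D where "D = 2 * (B / c) * (2 / c * L)"
  define C where "C = 1 + A + D + sqrt (3 * (1 + Q) * \<Lambda>) * A + 12 * (1 + Q)"
  \<comment> \<open>Since 4096 is the fourth power of 8, the first bound makes
    \<open>h powr (1/4)\<close> at most \<open>1 / 8\<close>. The second keeps edges and errors
    below \<open>\<eta>\<close>, and the third limits the rotation of the tangent as
    \<open>orientation_transfer\<close> requires.\<close>
  define h\<^sub>0 where "h\<^sub>0 = min (1 / 4096) (min (\<eta> / (2 + L + 2 * C\<^sub>q + 1)) (c\<^sup>2 / (8 * B)))"
  have K': "1 \<le> K'" "K \<le> K'" by (auto simp: K'_def)
  have pos: "0 < L" "0 < Q" "0 < \<Lambda>" "0 < A" "0 < D"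
    using K' assms(3,4) B_pos c_pos by (auto simp: L_def Q_def \<Lambda>_def A_def D_def)
  have C: "A \<le> C" "A + D \<le> C" "sqrt (3 * (1 + Q) * \<Lambda>) * A \<le> C" "12 * (1 + Q) \<le> C" "0 < C"
    using pos by (auto simp: C_def add_pos_nonneg)
  have h0: "0 < h\<^sub>0" using pos eta_pos assms(4) c_pos B_pos by (simp add: h\<^sub>0_def)
  show ?thesis
  proof (rule exI[of _ C], rule conjI[OF C(5)], rule exI[of _ h\<^sub>0], rule conjI[OF h0], intro allI impI, elim conjE)
    fix h \<tau> :: real and J l m :: nat and x :: "nat \<Rightarrow> nat \<Rightarrow> real^2"
    assume h: "0 < h" "h \<le> h\<^sub>0" and \<tau>: "0 < \<tau>" and l: "l < nat \<lfloor>T / \<tau>\<rfloor>"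
      and poly: "initial_polygon X \<delta> c\<^sub>q C\<^sub>q h J (x 0)"
      and nondeg: "\<forall>m\<le>l. nondegenerate J (Xhat X \<tau> x m)" and \<kappa>: "kappa X \<tau> J x l \<le> K"
      and ih: "\<forall>m\<le>l. induction_hypothesis X \<tau> J x h m" and ml: "m \<le> l"
    define G where "G = Xhat X \<tau> x"
    define s where "s = (\<lambda>m j. param_of X (real m * \<tau>) (Xhat X \<tau> x m j))"
    have time: "real i * \<tau> \<in> {0..T}" if "i \<le> l" for i
    proof -
      have "real i \<le> T / \<tau>" using l that by linarith
      then show ?thesis using \<tau> by (simp add: pos_le_divide_eq)
    qed
    have J: "3 \<le> J" and x0: "\<And>j. j < J \<Longrightarrow> c\<^sub>q * h \<le> elen J (x 0) j \<and> elen J (x 0) j \<le> C\<^sub>q * h"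
      using poly unfolding initial_polygon_def by auto
    have h1: "h \<le> 1 / 4096" "h * (2 + L + 2 * C\<^sub>q + 1) \<le> \<eta>" "h * (8 * B) \<le> c\<^sup>2"
      using h pos assms(4) B_pos by (auto simp: h\<^sub>0_def pos_le_divide_eq)
    have h54: "h powr (5/4) \<le> h"
      using powr_mono'[of 1 "5/4" h] h h1 by simp
    have h14: "h powr (1/4) \<le> 1 / 8"
    proof -
      have "h powr (1/4) \<le> ((1/8) powr 4) powr (1/4)"
        using h h1 by (intro powr_mono2) (auto simp: powr_numeral power_divide)
      also have "\<dots> = 1 / 8" unfolding powr_powr by simp
      finally show ?thesis .
    qed
    have \<eta>: "h < \<eta>" "L * h < \<eta>" "2 * (C\<^sub>q * h + h) < \<eta>"
    proof -
      have "0 < L * h" "0 < C\<^sub>q * h" using pos assms(4) h by auto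
      then show "h < \<eta>" "L * h < \<eta>" "2 * (C\<^sub>q * h + h) < \<eta>"
        using h1(2) h(1) by (auto simp: algebra_simps)
    qed
    have Bh: "2 * B / c * h \<le> c / 4"
      using h1(3) c_pos by (simp add: field_simps power2_eq_square)
    have e: "norm (ehat X \<tau> x i j) + norm (err X \<tau> x i j) \<le> h"
      "norm (tgrad J (G i) (ehat X \<tau> x i) j) + norm (tgrad J (G i) (err X \<tau> x i) j) \<le> 1 / 8"
      if "i \<le> l" "j < J" for i j
      using induction_hypothesis_bounds[OF ih[rule_format, OF that(1)] h(1) that(2)] h54 h14
      unfolding G_def by auto
    have Gpos: "0 < elen J (G i) j" if "i \<le> l" "j < J" for i j
      using nondeg that by (simp add: G_def nondegenerate_def elen_def edge_def)
    have x0pos: "0 < elen J (x 0) j" if "j < J" for j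
      using x0[OF that] mult_pos_pos[OF assms(3) h(1)] by linarith
    have kap: "elen J (G i) j \<le> K' * elen J (x 0) j" "elen J (x 0) j \<le> K' * elen J (G i) j"
      if "i \<le> l" "j < J" for i j
      using kappa_bounds[OF order_trans[OF \<kappa> K'(2)] that] Gpos[OF that] x0pos[OF that(2)]
      unfolding G_def elen_def by (simp_all add: pos_divide_le_eq)
    have fine: "elen J (G i) j \<le> L * h" if "i \<le> l" "j < J" for i j
    proof -
      have "elen J (G i) j \<le> K' * (C\<^sub>q * h)"
        using kap(1)[OF that] x0[OF that(2)] K' by (meson mult_left_mono order_trans zero_le_one)
      then show ?thesis by (simp add: L_def mult.assoc)
    qed
    have base: "ascending r J (s 0)" "(\<Sum>j<J. elen J (G 0) j) \<le> 2 * B"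
    proof -
      have *: "norm (x 0 j - proj X 0 (x 0 j)) \<le> h" if "j < J" for j
      proof -
        have eq: "x 0 j - proj X 0 (x 0 j) = ehat X \<tau> x 0 j" by (simp add: ehat_def Xhat_def)
        show ?thesis
          unfolding eq using e(1)[OF le0 that] norm_ge_zero[of "err X \<tau> x 0 j"] by linarith
      qed
      have "closed_curve (X 0) (curve_tangent X 0) (W 0) c B r \<eta>" using curves T by simp
      from initial_ascending[where X = X, OF this poly * \<eta>(3)]
      show "ascending r J (s 0)" "(\<Sum>j<J. elen J (G 0) j) \<le> 2 * B"
        by (simp_all add: s_def G_def Xhat_def[abs_def])
    qed
    \<comment> \<open>The exact curves at all levels share \<open>c\<close>, \<open>B\<close>,
      \<open>r\<close> and \<open>\<eta>\<close>, so each step reproduces the same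
      \<open>r\<close>.\<close>
    have asc: "ascending r J (s i)" if "i \<le> l" for i
      using that
    proof (induction i)
      case 0
      show ?case by (rule base)
    next
      case (Suc i)
      have il: "i \<le> l" using Suc by simp
      have "norm (edge J (G (Suc i)) j) < \<eta>" if "j < J" for j
        using fine[OF Suc.prems that] \<eta>(2) by (simp add: elen_def)
      then show ?case
        unfolding s_def
        using Suc.IH[OF il] nondeg Suc.prems e[OF Suc.prems] \<eta>(1) Bh
        by (intro ascending_step[where X = X and \<tau> = \<tau> and x = x and m = i and \<epsilon> = h,
              OF curves[OF time[OF il]] curves[OF time[OF Suc.prems]]])
          (simp_all only: s_def G_def)
    qed
    have ratio: "elen J (G m) i \<le> Q * elen J (G m) j" if "i < J" "j < J" for i j
    proof -
      have "elen J (G m) i \<le> K' * (C\<^sub>q * h)" using fine[OF ml that(1)] by (simp add: L_def mult.assoc)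
      also have "\<dots> = K' * C\<^sub>q / c\<^sub>q * (c\<^sub>q * h)" using assms(3) by simp
      also have "\<dots> \<le> K' * C\<^sub>q / c\<^sub>q * (K' * elen J (G m) j)"
        using x0[OF that(2)] kap(2)[OF ml that(2)] K' assms(3,4) by (intro mult_left_mono) auto
      finally show ?thesis by (simp add: Q_def power2_eq_square mult_ac)
    qed
    have total: "(\<Sum>j<J. elen J (G m) j) \<le> \<Lambda>"
    proof -
      have "(\<Sum>j<J. elen J (G m) j) \<le> (\<Sum>j<J. K'\<^sup>2 * elen J (G 0) j)"
      proof (rule sum_mono)
        fix j assume "j \<in> {..<J}"
        then have j: "j < J" by simp
        have "elen J (G m) j \<le> K' * elen J (x 0) j" by (rule kap[OF ml j])
        also have "\<dots> \<le> K' * (K' * elen J (G 0) j)" using kap(2)[OF _ j, of 0] K' by (intro mult_left_mono) auto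
        finally show "elen J (G m) j \<le> K'\<^sup>2 * elen J (G 0) j" by (simp add: power2_eq_square mult.assoc)
      qed
      also have "\<dots> = K'\<^sup>2 * (\<Sum>j<J. elen J (G 0) j)" by (simp add: sum_distrib_left)
      also have "\<dots> \<le> \<Lambda>" unfolding \<Lambda>_def using base(2) by (intro mult_left_mono) auto
      finally show ?thesis .
    qed
    let ?t = "real m * \<tau>"
    note cp = closest_point_on_curve[where X = X and t = ?t, OF curves[OF time[OF ml]]]
    define nstar where "nstar = interp (G m) (normal_ext \<sigma> X ?t)"
    \<comment> \<open>The nodes already lie on the curve, so the projection inside
      \<open>normal_ext\<close> fixes them and the exact normal at \<open>s m j\<close>
      appears.\<close>
    have n: "nstar j = \<sigma> *\<^sub>R quarter_turn (sgn (curve_tangent X ?t (s m j)))" for j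
      by (simp add: nstar_def interp_def normal_ext_def curve_normal_def unit_normal_eq s_def G_def Xhat_def cp(4))
    have Gs: "G m j = X ?t (s m j)" for j
      by (simp add: G_def s_def Xhat_def cp(3))
    have eh: "ehat X \<tau> x m = (\<lambda>j. x m j - G m j)" by (simp add: ehat_def G_def fun_eq_iff)
    have small: "norm (tgrad J (G m) (\<lambda>j. x m j - G m j) j) \<le> 1 / 2" if "j < J" for j
      using e(2)[OF ml that] norm_ge_zero[of "tgrad J (G m) (err X \<tau> x m) j"] unfolding eh by linarith
    have "0 < J" "h \<le> 1" using J h1 by auto
    note est = averaged_normal_estimates[OF curves[OF time[OF ml]] \<sigma> \<open>0 < J\<close> asc[OF ml] Gs n h(1) \<open>h \<le> 1\<close>
        fine[OF ml] Gpos[OF ml] ratio total small, folded A_def D_def]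
    have C': "k * y \<le> C * y" if "k \<le> C" "0 \<le> y" for k y using that by (rule mult_right_mono)
    have "Linfnorm J (fe J (\<lambda>j. avg_normal \<sigma> J (G m) j - nstar j)) \<le> C * h\<^sup>2"
      using order_trans[OF est(1) C'[OF C(1)]] by simp
    moreover have "L2norm J (G m) (fe J (\<lambda>j. avg_normal \<sigma> J (x m) j - nstar j))
        \<le> C * (h\<^sup>2 + L2norm J (G m) (\<lambda>j \<theta>. tgrad J (G m) (ehat X \<tau> x m) j))"
      unfolding distrib_left eh
      by (rule order_trans[OF est(2) add_mono[OF C'[OF C(3)] C'[OF C(4)]]]) (simp_all add: L2norm_nonneg)
    moreover have "Linfnorm J (\<lambda>j \<theta>. fe J (avg_normal \<sigma> J (G m)) j \<theta> - elt_normal \<sigma> J (G m) j) \<le> C * h"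
      using order_trans[OF est(3) C'[OF C(2)]] h by simp
    ultimately show "let G = Xhat X \<tau> x m; nstar = interp G (normal_ext \<sigma> X (real m * \<tau>)) in
        Linfnorm J (fe J (\<lambda>j. avg_normal \<sigma> J G j - nstar j)) \<le> C * h\<^sup>2 \<and>
        L2norm J G (fe J (\<lambda>j. avg_normal \<sigma> J (x m) j - nstar j))
          \<le> C * (h\<^sup>2 + L2norm J G (\<lambda>j \<theta>. tgrad J G (ehat X \<tau> x m) j)) \<and>
        Linfnorm J (\<lambda>j \<theta>. fe J (avg_normal \<sigma> J G) j \<theta> - elt_normal \<sigma> J G j) \<le> C * h"
      unfolding Let_def nstar_def G_def by blast
  qed
qed

end
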